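(* Let $k\in\mathbb{Z}^+$, let $\mathbb{H}_k = \{(z_1,z_2)\in\mathbb{C}^2 : |z_1|^k < |z_2| < 1\}$, and let $\mathbb{B}_k$ be the Bergman kernel of $\mathbb{H}_k$. Then $$\mathbb{B}_k(z,z)\approx \frac{1}{(1-|z_2|)^2(|z_2|-|z_1|^k)^2},\qquad z\in\mathbb{H}_k;$$ that is, there is a constant $K\ge 1$ (which may depend on $k$) such that for all $z=(z_1,z_2)\in\mathbb{H}_k$, $$\frac{K^{-1}}{(1-|z_2|)^2(|z_2|-|z_1|^k)^2}\le \mathbb{B}_k(z,z)\le \frac{K}{(1-|z_2|)^2(|z_2|-|z_1|^k)^2}.$$
   Context: For a domain $\Omega\subset\mathbb{C}^n$, the Bergman space $A^2(\Omega)$ is the Hilbert space of holomorphic functions on $\Omega$ that are square-integrable with respect to Lebesgue measure $dV$. The Bergman kernel of $\Omega$ is the function $\mathbb{B}_\Omega:\Omega\times\Omega\to\mathbb{C}$, given by the Riesz representation theorem, such that $\overline{\mathbb{B}_\Omega(z,\cdot)}\in A^2(\Omega)$ for each $z\in\Omega$ and $f(z)=\int_\Omega \mathbb{B}_\Omega(z,w)f(w)\,dV(w)$ for all $f\in A^2(\Omega)$, $z\in\Omega$. The notation $A\lesssim B$ means there is a constant $K>0$, independent of the relevant variables (here, of $z$), with $A\le K\cdot B$; $A\approx B$ means $A\lesssim B\lesssim A$. *)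

theory Defs
  imports "HOL-Analysis.Analysis"
begin

text \<open>Complex differentiability on an open set: the real Frechet derivative exists at every
  point and is \<open>\<complex>\<close>-linear (real linearity is already part of \<open>has_derivative\<close>).\<close>

definition holomorphic_on_Cn :: "((complex ^ 'n::finite) \<Rightarrow> complex) \<Rightarrow> (complex ^ 'n) set \<Rightarrow> bool"
  where "holomorphic_on_Cn f \<Omega> \<longleftrightarrow>
    (\<forall>z\<in>\<Omega>. \<exists>D. (f has_derivative D) (at z) \<and> (\<forall>c v. D (c *s v) = c * D v))"

text \<open>Members are total functions on \<open>\<complex>\<^sup>n\<close>; their values outside \<open>\<Omega>\<close> are irrelevant.\<close>

definition bergman_space :: "(complex ^ 'n::finite) set \<Rightarrow> ((complex ^ 'n) \<Rightarrow> complex) set"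
  where "bergman_space \<Omega> =
    {f. holomorphic_on_Cn f \<Omega> \<and> set_integrable lborel \<Omega> (\<lambda>w. (cmod (f w))\<^sup>2)}"

definition is_bergman_kernel ::
    "(complex ^ 'n::finite) set \<Rightarrow> ((complex ^ 'n) \<Rightarrow> (complex ^ 'n) \<Rightarrow> complex) \<Rightarrow> bool"
  where "is_bergman_kernel \<Omega> B \<longleftrightarrow>
    (\<forall>z\<in>\<Omega>. (\<lambda>w. cnj (B z w)) \<in> bergman_space \<Omega> \<and>
       (\<forall>f\<in>bergman_space \<Omega>. f z = (LINT w:\<Omega>|lborel. B z w * f w)))"

text \<open>The reproducing property determines the kernel only on \<open>\<Omega> \<times> \<Omega>\<close>. Requiring the value \<open>0\<close>
  elsewhere makes it unique as a total function.\<close>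

definition bergman_kernel ::
    "(complex ^ 'n::finite) set \<Rightarrow> (complex ^ 'n) \<Rightarrow> (complex ^ 'n) \<Rightarrow> complex"
  where "bergman_kernel \<Omega> =
    (THE B. is_bergman_kernel \<Omega> B \<and> (\<forall>z w. (z, w) \<notin> \<Omega> \<times> \<Omega> \<longrightarrow> B z w = 0))"

definition hartogs_triangle :: "nat \<Rightarrow> (complex ^ 2) set"
  where "hartogs_triangle k = {z. cmod (z $ 1) ^ k < cmod (z $ 2) \<and> cmod (z $ 2) < 1}"

end

theory Submission
  imports Defs "HOL-Complex_Analysis.Conformal_Mappings"
begin

text \<open>On the diagonal, the estimate becomes elementary as soon as the kernel is known in closed form. With
\<open>s = z\<^sub>1 w\<^sub>1\<^sup>*\<close> and \<open>t = z\<^sub>2 w\<^sub>2\<^sup>*\<close> (a star denotes conjugation) the kernel turns out to be a polynomial in \<open>s\<close> and \<open>t\<close>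
divided by \<open>k \<pi>\<^sup>2 (1 - t)\<^sup>2 (t - s\<^sup>k)\<^sup>2\<close>. For \<open>w = z\<close> the denominator is the product of the two factors in the claim
with \<open>k \<pi>\<^sup>2 (1 + \<bar>z\<^sub>2\<bar>)\<^sup>2 (\<bar>z\<^sub>2\<bar> + \<bar>z\<^sub>1\<bar>\<^sup>k)\<^sup>2\<close>, which is comparable to \<open>\<bar>z\<^sub>2\<bar>\<^sup>2\<close>; and the
numerator is comparable to \<open>\<bar>z\<^sub>2\<bar>\<^sup>2\<close> as well (\<open>hartogs_kernel_factor_bounds\<close>).

The closed form is obtained from the bidisc. The map \<open>\<Phi> (u, v) = (u v, v\<^sup>k)\<close> is a \<open>k\<close>-sheeted covering of the Hartogs triangle
by the product of the unit disc and the punctured unit disc, with complex Jacobian \<open>k v\<^sup>k\<close>; its deck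
transformations are generated by \<open>(u, v) \<mapsto> (\<omega>\<^sup>* u, \<omega> v)\<close>, where \<open>\<omega> = exp (2 \<pi> \<i> / k)\<close>. Sending \<open>f\<close> to \<open>v\<^sup>k f (\<Phi> (u, v))\<close>
carries the Bergman space of the triangle isometrically, up to a constant, to square integrable holomorphic functions that are
invariant under this group. Square integrability makes the puncture removable, so these functions are reproduced by
the kernel \<open>1 / (\<pi>\<^sup>2 (1 - X)\<^sup>2 (1 - Y)\<^sup>2)\<close> of the bidisc (\<open>bidisc_reproducing\<close>). Splitting \<open>1 / (1 - X)\<^sup>2\<close> according
to the residue of the exponent modulo \<open>k\<close> gives \<open>k\<close> parts, and invariance annihilates all products of
parts of different residues (\<open>bidisc_reproducing_symmetric\<close>). The \<open>k\<close> products that survive are rational functions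
of \<open>s\<close> and \<open>t\<close>, and their sum reproduces the Bergman space of the triangle (\<open>hartogs_kernel_reproducing\<close>).

The Bergman kernel is defined as the unique reproducing kernel with conjugate in the Bergman space, so membership
(\<open>cnj_hartogs_kernel_in_bergman_space\<close>) and uniqueness (\<open>bergman_kernel_unique\<close>) complete its identification with the explicit
function. The change of variables along \<open>\<Phi>\<close> is an identity of measures (\<open>density_lborel_eq_distr_hartogs_cover\<close>) derived from polar coordinates.\<close>

section \<open>Polar coordinates and the power map on the complex plane\<close>

lemma measurable_cis [measurable]: "cis \<in> borel_measurable borel"
  by (intro borel_measurable_continuous_onI continuous_intros)

lemma measurable_cnj [measurable]: "cnj \<in> borel_measurable borel"
  by (intro borel_measurable_continuous_onI continuous_intros)

lemma lborel_complex_eq_distr_vec: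
  "(lborel :: complex measure) = distr (lborel :: (real^2) measure) borel (\<lambda>x. Complex (x $ 1) (x $ 2))"
proof (rule lborel_eqI)
  have T[measurable]: "(\<lambda>x::real^2. Complex (x $ 1) (x $ 2)) \<in> borel_measurable borel"
    unfolding complex_eq by (intro borel_measurable_continuous_onI continuous_intros)
  fix l u :: complex
  assume le: "\<And>b. b \<in> Basis \<Longrightarrow> l \<bullet> b \<le> u \<bullet> b"
  have le': "Re l \<le> Re u" "Im l \<le> Im u"
    using le[of 1] le[of \<i>] by (auto simp: Basis_complex_def inner_complex_def)
  have "(\<lambda>x::real^2. Complex (x $ 1) (x $ 2)) -` box l u
      = box (vector [Re l, Im l]) (vector [Re u, Im u])"
    by (rule set_eqI) (auto simp: mem_box_cart forall_2 in_box_complex_iff)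
  then have "emeasure (distr (lborel :: (real^2) measure) borel (\<lambda>x. Complex (x $ 1) (x $ 2))) (box l u)
     = emeasure lborel (box (vector [Re l, Im l]) (vector [Re u, Im u] :: real^2))"
    by (subst emeasure_distr) auto
  also have "\<dots> = ennreal ((Re u - Re l) * (Im u - Im l))"
    using le' by (subst emeasure_lborel_box_eq)
      (auto simp: Basis_vec_def prod.UNION_disjoint UNIV_2 axis_eq_axis inner_axis ball_Un)
  also have "(Re u - Re l) * (Im u - Im l) = (\<Prod>b\<in>Basis. (u - l) \<bullet> b)"
    by (simp add: Basis_complex_def inner_complex_def)
  finally show "emeasure (distr (lborel :: (real^2) measure) borel (\<lambda>x. Complex (x $ 1) (x $ 2))) (box l u)
      = (\<Prod>b\<in>Basis. (u - l) \<bullet> b)" .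
qed simp

text \<open>On \<open>\<real>\<^sup>2\<close>, multiplication by \<open>c\<close> is a linear map of determinant \<open>\<bar>c\<bar>\<^sup>2\<close>. This one fact supplies both
the rotations behind polar coordinates and the fibrewise scaling of the covering map below.\<close>

lemma distr_lborel_complex_mult:
  fixes c :: complex
  assumes c: "c \<noteq> 0"
  shows "(lborel :: complex measure) = density (distr lborel borel (\<lambda>w. c * w)) (\<lambda>_. ennreal ((cmod c)\<^sup>2))"
proof (rule lborel_eqI)
  let ?T = "\<lambda>x::real^2. Complex (x $ 1) (x $ 2)"
  let ?S = "\<lambda>z. vector [Re z, Im z] :: real^2"
  define d where "d = inverse c"
  define L :: "real^2 \<Rightarrow> real^2" where "L = (\<lambda>x. ?S (d * ?T x))"
  have TS: "?T (?S z) = z" for z by (simp add: vector_2)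
  have ST: "vector [x $ 1, x $ 2] = x" for x :: "real^2" by (simp add: vec_eq_iff forall_2 vector_2)
  have T[measurable]: "?T \<in> borel_measurable borel"
    unfolding complex_eq by (intro borel_measurable_continuous_onI continuous_intros)
  have lin: "linear L"
    by (rule linearI) (auto simp: L_def vec_eq_iff forall_2 vector_2 algebra_simps)
  have "det (matrix L) = (Re d)\<^sup>2 + (Im d)\<^sup>2"
    by (simp add: det_2 matrix_def L_def vector_2 axis_def power2_eq_square)
  then have det: "\<bar>det (matrix L)\<bar> = (cmod d)\<^sup>2"
    by (simp add: cmod_power2)
  fix l u :: complex
  assume le: "\<And>b. b \<in> Basis \<Longrightarrow> l \<bullet> b \<le> u \<bullet> b"
  define A where "A = ?T -` box l u"
  have A_box: "A = box (?S l) (?S u)"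
    unfolding A_def by (rule set_eqI) (auto simp: mem_box_cart forall_2 in_box_complex_iff)
  have A: "A \<in> lmeasurable" unfolding A_box by simp
  have LA: "L ` A \<in> lmeasurable" "measure lebesgue (L ` A) = (cmod d)\<^sup>2 * measure lebesgue A"
    using measurable_linear_image[OF lin A] measure_linear_image[OF lin A] det by auto
  have eq: "?T -` ((\<lambda>w. c * w) -` box l u) = L ` A"
  proof (intro equalityI subsetI)
    fix x assume "x \<in> ?T -` ((\<lambda>w. c * w) -` box l u)"
    then have "?S (c * ?T x) \<in> A" "L (?S (c * ?T x)) = x"
      unfolding A_def L_def vimage_eq TS using c by (auto simp: d_def mult.assoc[symmetric] ST)
    then show "x \<in> L ` A" by (metis imageI)
  next
    fix x assume "x \<in> L ` A"
    then obtain y where "y \<in> A" "x = L y" by blast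
    then have "?T y \<in> box l u" "c * ?T x = ?T y"
      using c by (simp_all only: A_def L_def TS vimage_eq d_def mult.assoc[symmetric]) simp_all
    then show "x \<in> ?T -` ((\<lambda>w. c * w) -` box l u)" by simp
  qed
  have mc: "(\<lambda>w. c * w) -` box l u \<in> sets borel"
    by (intro measurable_sets_borel[of _ borel]) auto
  have "emeasure (distr lborel borel (\<lambda>w. c * w)) (box l u) = emeasure lborel ((\<lambda>w. c * w) -` box l u)"
    by (subst emeasure_distr) auto
  also have "\<dots> = emeasure lborel (?T -` ((\<lambda>w. c * w) -` box l u))"
    using mc by (subst lborel_complex_eq_distr_vec, subst emeasure_distr) auto
  also have "\<dots> = emeasure lebesgue (L ` A)"
    unfolding eq[symmetric] using measurable_sets_borel[OF T mc] by simp
  also have "\<dots> = ennreal ((cmod d)\<^sup>2) * emeasure lebesgue A"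
    using LA A by (simp add: emeasure_eq_measure2 fmeasurableD2 ennreal_mult)
  also have "emeasure lebesgue A = emeasure lborel A"
    unfolding A_box by simp
  also have "emeasure lborel A = emeasure lborel (box l u)"
    by (subst lborel_complex_eq_distr_vec, subst emeasure_distr) (auto simp: A_def)
  also have "\<dots> = (\<Prod>b\<in>Basis. (u - l) \<bullet> b)"
    using le by (simp add: emeasure_lborel_box)
  finally have "emeasure (distr lborel borel (\<lambda>w. c * w)) (box l u)
      = ennreal ((cmod d)\<^sup>2) * ennreal (\<Prod>b\<in>Basis. (u - l) \<bullet> b)" .
  moreover have "ennreal ((cmod c)\<^sup>2) * ennreal ((cmod d)\<^sup>2) = 1"
    using c by (simp add: d_def norm_inverse ennreal_mult[symmetric] power_mult_distrib[symmetric])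
  ultimately show "emeasure (density (distr lborel borel (\<lambda>w. c * w)) (\<lambda>_. ennreal ((cmod c)\<^sup>2))) (box l u)
     = (\<Prod>b\<in>Basis. (u - l) \<bullet> b)"
    by (simp add: emeasure_density nn_integral_cmult mult.assoc[symmetric])
qed simp

lemma nn_integral_complex_mult:
  fixes c :: complex
  assumes "c \<noteq> 0" and [measurable]: "f \<in> borel_measurable borel"
  shows "(\<integral>\<^sup>+w. f w \<partial>lborel) = ennreal ((cmod c)\<^sup>2) * (\<integral>\<^sup>+w. f (c * w) \<partial>lborel)"
  by (subst distr_lborel_complex_mult[OF assms(1)])
     (simp add: nn_integral_density nn_integral_distr nn_integral_cmult)

text \<open>Both sides give the set of radii below \<open>R\<close> the area \<open>\<pi> R\<^sup>2\<close> of a disc. The proof reflects the real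
line so that the half-lines on which the measures are compared have finite mass.\<close>

lemma distr_lborel_cmod:
  "distr lborel borel cmod = density lborel (\<lambda>r. ennreal (2 * pi * r * indicator {0..} r))"
proof -
  let ?M = "distr lborel borel (\<lambda>w. - cmod w)"
  let ?N = "distr (density lborel (\<lambda>r. ennreal (2 * pi * r * indicator {0..} r))) borel uminus"
  have N: "emeasure ?N {x<..} = ennreal (if x < 0 then pi * x\<^sup>2 else 0)" for x :: real
  proof -
    have "uminus -` {x<..} = {..<-x}" by auto
    then have "emeasure ?N {x<..} = emeasure (density lborel (\<lambda>r. ennreal (2 * pi * r * indicator {0..} r))) {..<-x}"
      by (subst emeasure_distr) simp_all
    also have "\<dots> = (\<integral>\<^sup>+r. ennreal (2 * pi * r) * indicator {0..-x} r \<partial>lborel)"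
    proof -
      have "AE r in lborel. ennreal (2 * pi * r * indicator {0..} r) * indicator {..<-x} r
          = ennreal (2 * pi * r) * indicator {0..-x} r"
        using AE_lborel_singleton[of "-x"] by eventually_elim (auto simp: indicator_def)
      then show ?thesis
        by (subst emeasure_density) (auto intro: nn_integral_cong_AE)
    qed
    also have "\<dots> = ennreal (if x < 0 then pi * x\<^sup>2 else 0)"
    proof (cases "x < 0")
      case True
      then show ?thesis
        by (subst nn_integral_FTC_Icc[where F="\<lambda>r. pi * r\<^sup>2"])
           (auto intro!: derivative_eq_intros)
    next
      case False
      then have "(\<integral>\<^sup>+r. ennreal (2 * pi * r) * indicator {0..-x} r \<partial>lborel) = (\<integral>\<^sup>+r. 0 \<partial>(lborel::real measure))"
        by (intro nn_integral_cong) (auto split: split_indicator)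
      then show ?thesis using False by simp
    qed
    finally show ?thesis .
  qed
  have M: "emeasure ?M {x<..} = ennreal (if x < 0 then pi * x\<^sup>2 else 0)" for x :: real
  proof -
    have "(\<lambda>w::complex. - cmod w) -` {x<..} = ball 0 (-x)" by auto
    then have "emeasure ?M {x<..} = emeasure lborel (ball (0::complex) (-x))"
      by (subst emeasure_distr) simp_all
    also have "\<dots> = ennreal (if x < 0 then pi * x\<^sup>2 else 0)"
    proof (cases "x < 0")
      case True then show ?thesis
        by (subst emeasure_ball) (auto simp: unit_ball_vol_2)
    next
      case False then have "ball (0::complex) (-x) = {}" by (simp add: ball_empty)
      then show ?thesis using False by (metis emeasure_empty ennreal_0)
    qed
    finally show ?thesis .
  qed
  have "?M = ?N"
    by (rule measure_eqI_lessThan) (auto simp: M N)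
  then have *: "distr ?M borel uminus = distr ?N borel uminus" by simp
  have "distr ?M borel uminus = distr lborel borel cmod"
    by (subst distr_distr) (auto simp: o_def)
  moreover have "distr ?N borel uminus = density lborel (\<lambda>r. ennreal (2 * pi * r * indicator {0..} r))"
    by (subst distr_distr) (auto simp: o_def intro: distr_id2)
  ultimately show ?thesis using * by simp
qed

lemma nn_integral_periodic_shift:
  fixes p :: "real \<Rightarrow> ennreal"
  assumes [measurable]: "p \<in> borel_measurable borel"
    and per: "\<And>x. p (x + T) = p x" and a: "0 \<le> a" "a \<le> T"
  shows "(\<integral>\<^sup>+x. p (a + x) * indicator {0..<T} x \<partial>lborel) = (\<integral>\<^sup>+x. p x * indicator {0..<T} x \<partial>lborel)"
proof -
  have "(\<integral>\<^sup>+x. p (a + x) * indicator {0..<T} x \<partial>lborel)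
      = (\<integral>\<^sup>+x. p x * indicator {a..<T + a} x \<partial>lborel)"
    by (subst (2) nn_integral_real_affine[where c=1 and t=a])
       (auto intro!: nn_integral_cong simp: indicator_def)
  \<comment> \<open>The part of the shifted period that sticks out beyond \<open>T\<close> is moved back by one period.\<close>
  also have "\<dots> = (\<integral>\<^sup>+x. p x * indicator {a..<T} x + p x * indicator {T..<T + a} x \<partial>lborel)"
    using a by (intro nn_integral_cong) (auto simp: indicator_def)
  also have "\<dots> = (\<integral>\<^sup>+x. p x * indicator {a..<T} x \<partial>lborel) + (\<integral>\<^sup>+x. p x * indicator {T..<T + a} x \<partial>lborel)"
    by (rule nn_integral_add) auto
  also have "(\<integral>\<^sup>+x. p x * indicator {T..<T + a} x \<partial>lborel) = (\<integral>\<^sup>+x. p x * indicator {0..<a} x \<partial>lborel)"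
    by (subst nn_integral_real_affine[where c=1 and t=T])
       (auto intro!: nn_integral_cong simp: indicator_def per add.commute[of T])
  also have "(\<integral>\<^sup>+x. p x * indicator {a..<T} x \<partial>lborel) + \<dots>
      = (\<integral>\<^sup>+x. p x * indicator {a..<T} x + p x * indicator {0..<a} x \<partial>lborel)"
    by (rule nn_integral_add[symmetric]) auto
  also have "\<dots> = (\<integral>\<^sup>+x. p x * indicator {0..<T} x \<partial>lborel)"
    using a by (intro nn_integral_cong) (auto simp: indicator_def)
  finally show ?thesis .
qed

text \<open>As \<open>x\<close> runs through one period, \<open>k x\<close> runs through \<open>k\<close> periods at \<open>k\<close> times the speed.\<close>

lemma nn_integral_periodic_mult:
  fixes p :: "real \<Rightarrow> ennreal"
  assumes [measurable]: "p \<in> borel_measurable borel"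
    and per: "\<And>x. p (x + T) = p x" and T: "0 < T" and k: "k \<ge> (1::nat)"
  shows "(\<integral>\<^sup>+x. p (real k * x) * indicator {0..<T} x \<partial>lborel) = (\<integral>\<^sup>+x. p x * indicator {0..<T} x \<partial>lborel)"
proof -
  have pern: "p (x + real n * T) = p x" for x n
  proof (induction n)
    case (Suc n)
    have "p (x + real (Suc n) * T) = p ((x + real n * T) + T)" by (simp add: algebra_simps)
    then show ?case using Suc per by simp
  qed simp
  have add: "(\<integral>\<^sup>+x. p x * indicator {0..<real n * T} x \<partial>lborel)
      = of_nat n * (\<integral>\<^sup>+x. p x * indicator {0..<T} x \<partial>lborel)" for n
  proof (induction n)
    case (Suc n)
    have "(\<integral>\<^sup>+x. p x * indicator {0..<real (Suc n) * T} x \<partial>lborel)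
      = (\<integral>\<^sup>+x. p x * indicator {0..<real n * T} x + p x * indicator {real n * T..<real n * T + T} x \<partial>lborel)"
      using T by (intro nn_integral_cong) (auto simp: indicator_def algebra_simps intro: add_nonneg_nonneg order_trans[of _ "real n * T"])
    also have "\<dots> = (\<integral>\<^sup>+x. p x * indicator {0..<real n * T} x \<partial>lborel)
        + (\<integral>\<^sup>+x. p x * indicator {real n * T..<real n * T + T} x \<partial>lborel)"
      by (rule nn_integral_add) auto
    also have "(\<integral>\<^sup>+x. p x * indicator {real n * T..<real n * T + T} x \<partial>lborel)
        = (\<integral>\<^sup>+x. p x * indicator {0..<T} x \<partial>lborel)"
      by (subst nn_integral_real_affine[where c=1 and t="real n * T"])
         (auto intro!: nn_integral_cong simp: indicator_def pern add.commute[of "real n * T"])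
    finally show ?case unfolding Suc by (simp add: distrib_right add.commute)
  qed simp
  have "of_nat k * (\<integral>\<^sup>+x. p (real k * x) * indicator {0..<T} x \<partial>lborel)
      = (\<integral>\<^sup>+x. p x * indicator {0..<real k * T} x \<partial>lborel)"
    using k by (subst (2) nn_integral_real_affine[where c="real k" and t=0])
       (auto intro!: nn_integral_cong arg_cong2[where f="(*)"] simp: indicator_def ennreal_of_nat_eq_real_of_nat zero_le_mult_iff)
  also have "\<dots> = of_nat k * (\<integral>\<^sup>+x. p x * indicator {0..<T} x \<partial>lborel)" by (rule add)
  finally show ?thesis
    using k by (simp add: ennreal_mult_cancel_left)
qed

text \<open>Averaging over all rotations does not change the integral and replaces \<open>f\<close> by its mean over
circles, a function of \<open>\<bar>w\<bar>\<close> alone; the law of \<open>\<bar>w\<bar>\<close> then gives the radial part.\<close>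

lemma nn_integral_polar:
  assumes [measurable]: "f \<in> borel_measurable borel"
  shows "(\<integral>\<^sup>+w. f w \<partial>(lborel :: complex measure))
    = (\<integral>\<^sup>+r. (\<integral>\<^sup>+\<theta>. f (of_real r * cis \<theta>) * indicator {0..<2*pi} \<theta> \<partial>lborel) * ennreal (r * indicator {0..} r) \<partial>lborel)"
proof -
  define A where "A = (\<lambda>r::real. \<integral>\<^sup>+\<theta>. f (of_real r * cis \<theta>) * indicator {0..<2*pi} \<theta> \<partial>lborel)"
  have A[measurable]: "A \<in> borel_measurable borel"
    unfolding A_def by measurable
  \<comment> \<open>Rotating \<open>w\<close> through all angles only shifts the angular variable by \<open>Arg2pi w\<close>.\<close>
  have rot: "(\<integral>\<^sup>+\<theta>. f (cis \<theta> * w) * indicator {0..<2*pi} \<theta> \<partial>lborel) = A (cmod w)" for w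
  proof -
    have w: "w = of_real (cmod w) * cis (Arg2pi w)"
      using Arg2pi_eq[of w] by (simp add: exp_eq_polar)
    have "(\<integral>\<^sup>+\<theta>. f (cis \<theta> * w) * indicator {0..<2*pi} \<theta> \<partial>lborel)
        = (\<integral>\<^sup>+\<theta>. f (of_real (cmod w) * cis (Arg2pi w + \<theta>)) * indicator {0..<2*pi} \<theta> \<partial>lborel)"
      by (subst (1) w) (simp add: cis_mult[symmetric] mult_ac)
    also have "\<dots> = A (cmod w)"
      unfolding A_def
      by (rule nn_integral_periodic_shift[where p="\<lambda>\<theta>. f (of_real (cmod w) * cis \<theta>)"])
         (auto simp: Arg2pi_ge_0 less_imp_le[OF Arg2pi_lt_2pi] cis_mult[symmetric])
    finally show ?thesis .
  qed
  have "ennreal (2 * pi) * (\<integral>\<^sup>+w. f w \<partial>lborel)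
      = (\<integral>\<^sup>+\<theta>. (\<integral>\<^sup>+w. f w \<partial>lborel) * indicator {0..<2*pi} \<theta> \<partial>lborel)"
    by (simp add: nn_integral_cmult_indicator mult.commute)
  also have "\<dots> = (\<integral>\<^sup>+\<theta>. (\<integral>\<^sup>+w. f (cis \<theta> * w) * indicator {0..<2*pi} \<theta> \<partial>lborel) \<partial>lborel)"
    by (intro nn_integral_cong, subst nn_integral_complex_mult[of "cis _"])
       (auto simp: nn_integral_multc)
  also have "\<dots> = (\<integral>\<^sup>+w. (\<integral>\<^sup>+\<theta>. f (cis \<theta> * w) * indicator {0..<2*pi} \<theta> \<partial>lborel) \<partial>lborel)"
    by (rule lborel_pair.Fubini') measurable
  also have "\<dots> = (\<integral>\<^sup>+w. A (cmod w) \<partial>lborel)"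
    by (simp add: rot)
  also have "\<dots> = (\<integral>\<^sup>+r. A r \<partial>(distr lborel borel cmod))"
    by (simp add: nn_integral_distr)
  also have "\<dots> = (\<integral>\<^sup>+r. ennreal (2 * pi) * (A r * ennreal (r * indicator {0..} r)) \<partial>lborel)"
    unfolding distr_lborel_cmod
    by (subst nn_integral_density) (auto intro!: nn_integral_cong simp: ennreal_mult[symmetric] indicator_def ennreal_mult' mult_ac)
  also have "\<dots> = ennreal (2 * pi) * (\<integral>\<^sup>+r. A r * ennreal (r * indicator {0..} r) \<partial>lborel)"
    by (rule nn_integral_cmult) simp
  finally show ?thesis
    by (simp add: ennreal_mult_cancel_left A_def)
qed

text \<open>The map \<open>v \<mapsto> v\<^sup>k\<close> winds the disc \<open>k\<close> times around itself and has Jacobian \<open>k\<^sup>2 \<bar>v\<bar>\<^bsup>2(k-1)\<^esup>\<close>, which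
leaves the weight \<open>k \<bar>v\<bar>\<^bsup>2(k-1)\<^esup>\<close>. In polar coordinates the radii and the angles separate: the
angular mean is unaffected by \<open>\<theta> \<mapsto> k \<theta>\<close>, and the radii undergo the substitution \<open>r \<mapsto> r\<^sup>k\<close>.\<close>

lemma nn_integral_power_disc:
  assumes [measurable]: "f \<in> borel_measurable borel" and k: "k \<ge> 1"
  shows "(\<integral>\<^sup>+w. f w * indicator (cball 0 1) w \<partial>(lborel :: complex measure))
    = (\<integral>\<^sup>+v. f (v ^ k) * ennreal (real k * cmod v ^ (2 * (k - 1))) * indicator (cball 0 1) v \<partial>lborel)"
proof -
  have cb[measurable]: "cball (0::complex) 1 \<in> sets borel" by simp
  define A where "A = (\<lambda>r::real. \<integral>\<^sup>+\<theta>. f (of_real r * cis \<theta>) * indicator {0..<2*pi} \<theta> \<partial>lborel)"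
  have A[measurable]: "A \<in> borel_measurable borel"
    unfolding A_def by measurable
  have Ak: "(\<integral>\<^sup>+\<theta>. f ((of_real r * cis \<theta>) ^ k) * indicator {0..<2*pi} \<theta> \<partial>lborel) = A (r ^ k)" for r
    unfolding A_def power_mult_distrib Complex.DeMoivre of_real_power[symmetric]
    using k by (subst nn_integral_periodic_mult[where p="\<lambda>\<theta>. f (of_real (r ^ k) * cis \<theta>)"])
       (auto simp: cis_mult[symmetric])
  have "(\<integral>\<^sup>+w. f w * indicator (cball 0 1) w \<partial>(lborel :: complex measure))
      = (\<integral>\<^sup>+r. (\<integral>\<^sup>+\<theta>. f (of_real r * cis \<theta>) * indicator (cball 0 1) (of_real r * cis \<theta>)
          * indicator {0..<2*pi} \<theta> \<partial>lborel) * ennreal (r * indicator {0..} r) \<partial>lborel)"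
    by (rule nn_integral_polar) measurable
  also have "\<dots> = (\<integral>\<^sup>+r. (A r * ennreal r) * indicator {0..1} r \<partial>lborel)"
    unfolding A_def by (intro nn_integral_cong) (auto simp: norm_mult indicator_def)
  also have "\<dots> = (\<integral>\<^sup>+r. (A r * ennreal r) * indicator {0 ^ k..1 ^ k} r \<partial>lborel)"
    using k by (simp add: power_0_left)
  also have "\<dots> = (\<integral>\<^sup>+r. (A (r ^ k) * ennreal (r ^ k)) * ennreal (real k * r ^ (k - 1)) * indicator {0..1} r \<partial>lborel)"
    by (rule nn_integral_substitution_aux) (auto intro!: derivative_eq_intros continuous_intros)
  also have "\<dots> = (\<integral>\<^sup>+v. f (v ^ k) * ennreal (real k * cmod v ^ (2 * (k - 1))) * indicator (cball 0 1) v \<partial>lborel)"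
  proof (subst nn_integral_polar, simp, intro nn_integral_cong)
    fix r :: real
    have *: "r ^ k * (real k * r ^ (k - 1)) = real k * r ^ (2 * (k - 1)) * r"
      using k by (cases k) (auto simp: power_add power_mult power2_eq_square mult_ac mult_2)
    show "A (r ^ k) * ennreal (r ^ k) * ennreal (real k * r ^ (k - 1)) * indicator {0..1} r
      = (\<integral>\<^sup>+\<theta>. f ((of_real r * cis \<theta>) ^ k) * ennreal (real k * cmod (of_real r * cis \<theta>) ^ (2 * (k - 1)))
         * indicator (cball 0 1) (of_real r * cis \<theta>) * indicator {0..<2*pi} \<theta> \<partial>lborel) * ennreal (r * indicator {0..} r)"
      (is "_ = ?I * _")
    proof (cases "0 \<le> r \<and> r \<le> 1")
      case True
      then have "(\<integral>\<^sup>+\<theta>. f ((of_real r * cis \<theta>) ^ k) * ennreal (real k * cmod (of_real r * cis \<theta>) ^ (2 * (k - 1)))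
         * indicator (cball 0 1) (of_real r * cis \<theta>) * indicator {0..<2*pi} \<theta> \<partial>lborel)
         = (\<integral>\<^sup>+\<theta>. ennreal (real k * r ^ (2 * (k - 1))) * (f ((of_real r * cis \<theta>) ^ k) * indicator {0..<2*pi} \<theta>) \<partial>lborel)"
        by (intro nn_integral_cong) (auto simp: norm_mult mult_ac)
      also have "\<dots> = ennreal (real k * r ^ (2 * (k - 1))) * A (r ^ k)"
        by (subst nn_integral_cmult) (auto simp: Ak)
      finally have eq: "?I = ennreal (real k * r ^ (2 * (k - 1))) * A (r ^ k)" .
      have "A (r ^ k) * ennreal (r ^ k) * ennreal (real k * r ^ (k - 1))
          = A (r ^ k) * ennreal (r ^ k * (real k * r ^ (k - 1)))"
        using True by (simp add: mult.assoc ennreal_mult[symmetric])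
      also have "\<dots> = ennreal (real k * r ^ (2 * (k - 1))) * A (r ^ k) * ennreal r"
        unfolding * using True by (simp add: ennreal_mult mult_ac)
      finally show ?thesis unfolding eq using True by simp
    next
      case False
      then show ?thesis by (auto simp: norm_mult indicator_def)
    qed
  qed
  finally show ?thesis .
qed

text \<open>Polar coordinates as an identity of measures, so that they also apply to complex-valued
integrands.\<close>

lemma lborel_eq_distr_polar:
  "(lborel :: complex measure) = distr (density (lborel \<Otimes>\<^sub>M lborel)
     (\<lambda>p. ennreal ((fst p * indicator {0..} (fst p)) * indicator {0..<2*pi} (snd p)))) borel
     (\<lambda>p. of_real (fst p) * cis (snd p))"
  (is "_ = ?N")
proof (rule measure_eqI)
  fix A assume "A \<in> sets (lborel :: complex measure)"
  then have [measurable]: "A \<in> sets borel" by simp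
  have "emeasure lborel A = (\<integral>\<^sup>+w. indicator A w \<partial>lborel)"
    by simp
  also have "\<dots> = (\<integral>\<^sup>+r. (\<integral>\<^sup>+\<theta>. indicator A (of_real r * cis \<theta>) * indicator {0..<2*pi} \<theta> \<partial>lborel) * ennreal (r * indicator {0..} r) \<partial>lborel)"
    by (rule nn_integral_polar) simp
  also have "\<dots> = (\<integral>\<^sup>+r. (\<integral>\<^sup>+\<theta>. ennreal ((r * indicator {0..} r) * indicator {0..<2*pi} \<theta>) * indicator A (of_real r * cis \<theta>) \<partial>lborel) \<partial>lborel)"
  proof (rule nn_integral_cong)
    fix r :: real
    have "(\<integral>\<^sup>+\<theta>. indicator A (of_real r * cis \<theta>) * indicator {0..<2*pi} \<theta> \<partial>lborel) * ennreal (r * indicator {0..} r)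
      = (\<integral>\<^sup>+\<theta>. indicator A (of_real r * cis \<theta>) * indicator {0..<2*pi} \<theta> * ennreal (r * indicator {0..} r) \<partial>lborel)"
      by (rule nn_integral_multc[symmetric]) measurable
    also have "\<dots> = (\<integral>\<^sup>+\<theta>. ennreal ((r * indicator {0..} r) * indicator {0..<2*pi} \<theta>) * indicator A (of_real r * cis \<theta>) \<partial>lborel)"
      by (intro nn_integral_cong) (auto simp: indicator_def)
    finally show "(\<integral>\<^sup>+\<theta>. indicator A (of_real r * cis \<theta>) * indicator {0..<2*pi} \<theta> \<partial>lborel) * ennreal (r * indicator {0..} r)
      = (\<integral>\<^sup>+\<theta>. ennreal ((r * indicator {0..} r) * indicator {0..<2*pi} \<theta>) * indicator A (of_real r * cis \<theta>) \<partial>lborel)" .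
  qed
  also have "\<dots> = (\<integral>\<^sup>+p. ennreal ((fst p * indicator {0..} (fst p)) * indicator {0..<2*pi} (snd p)) * indicator A (of_real (fst p) * cis (snd p)) \<partial>(lborel \<Otimes>\<^sub>M lborel))"
    by (subst lborel.nn_integral_fst[symmetric]) auto
  also have "\<dots> = (\<integral>\<^sup>+w. indicator A w \<partial>?N)"
    by (subst nn_integral_distr, measurable, subst nn_integral_density) auto
  also have "\<dots> = emeasure ?N A"
    by (rule nn_integral_indicator) simp
  finally show "emeasure lborel A = emeasure ?N A" .
qed simp

section \<open>Change of variables along the covering map\<close>

text \<open>Iterated integrals live on pairs, the domain in \<open>\<complex>\<^sup>2\<close> on vectors; this is the identification.\<close>

definition pair_vec :: "complex \<times> complex \<Rightarrow> complex ^ 2"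
  where "pair_vec p = (\<chi> i. if i = 1 then fst p else snd p)"

lemma pair_vec_nth [simp]: "pair_vec p $ 1 = fst p" "pair_vec p $ 2 = snd p"
  by (simp_all add: pair_vec_def)

lemma continuous_on_pair_vec [continuous_intros]:
  "continuous_on S f \<Longrightarrow> continuous_on S (\<lambda>x. pair_vec (f x))"
  unfolding pair_vec_def
proof (rule continuous_on_vec_lambda)
  fix i :: 2
  assume "continuous_on S f"
  then show "continuous_on S (\<lambda>x. if i = 1 then fst (f x) else snd (f x))"
    by (cases "i = 1") (auto intro!: continuous_intros)
qed

lemma measurable_pair_vec [measurable]: "pair_vec \<in> lborel \<Otimes>\<^sub>M lborel \<rightarrow>\<^sub>M borel"
proof -
  have "pair_vec \<in> borel_measurable borel"
    by (intro borel_measurable_continuous_onI continuous_intros)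
  then show ?thesis by (simp add: borel_prod[symmetric] cong: measurable_cong_sets sets_pair_measure_cong)
qed

lemma lborel_vec2_eq_distr:
  "(lborel :: (complex^2) measure) = distr (lborel \<Otimes>\<^sub>M lborel) borel pair_vec"
proof (rule lborel_eqI)
  fix l u :: "complex^2"
  assume le: "\<And>b. b \<in> Basis \<Longrightarrow> l \<bullet> b \<le> u \<bullet> b"
  have B: "(Basis :: (complex^2) set) = {axis 1 1, axis 1 \<i>, axis 2 1, axis 2 \<i>}"
    by (auto simp: Basis_vec_def Basis_complex_def UNIV_2)
  have le': "l $ i \<bullet> b \<le> u $ i \<bullet> b" if "b \<in> Basis" for i b
    using le[of "axis i b"] that by (simp add: inner_axis axis_in_Basis_iff)
  have "pair_vec -` box l u = box (l $ 1) (u $ 1) \<times> box (l $ 2) (u $ 2)"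
    by (auto simp: box_def B inner_axis Basis_complex_def)
  then have "emeasure (distr (lborel \<Otimes>\<^sub>M lborel) borel pair_vec) (box l u)
      = emeasure (lborel \<Otimes>\<^sub>M lborel) (box (l $ 1) (u $ 1) \<times> box (l $ 2) (u $ 2))"
    by (subst emeasure_distr) (auto simp: space_pair_measure)
  also have "\<dots> = ennreal (\<Prod>b\<in>Basis. (u $ 1 - l $ 1) \<bullet> b) * ennreal (\<Prod>b\<in>Basis. (u $ 2 - l $ 2) \<bullet> b)"
    using le' by (subst lborel.emeasure_pair_measure_Times) (auto simp: emeasure_lborel_box)
  also have "\<dots> = ennreal ((\<Prod>b\<in>Basis. (u $ 1 - l $ 1) \<bullet> b) * (\<Prod>b\<in>Basis. (u $ 2 - l $ 2) \<bullet> b))"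
    using le' by (intro ennreal_mult[symmetric] prod_nonneg) (auto simp: inner_diff_left)
  also have "(\<Prod>b\<in>Basis. (u $ 1 - l $ 1) \<bullet> b) * (\<Prod>b\<in>Basis. (u $ 2 - l $ 2) \<bullet> b) = (\<Prod>b\<in>Basis. (u - l) \<bullet> b)"
    unfolding B by (simp add: axis_eq_axis inner_axis Basis_complex_def mult.assoc)
  finally show "emeasure (distr (lborel \<Otimes>\<^sub>M lborel) borel pair_vec) (box l u) = (\<Prod>b\<in>Basis. (u - l) \<bullet> b)" .
qed simp

text \<open>On the product of the unit disc and the punctured unit disc this is a \<open>k\<close>-sheeted covering of the
Hartogs triangle.\<close>

definition hartogs_cover :: "nat \<Rightarrow> complex \<times> complex \<Rightarrow> complex ^ 2"
  where "hartogs_cover k p = pair_vec (fst p * snd p, snd p ^ k)"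

lemma hartogs_cover_nth [simp]:
  "hartogs_cover k (u, v) $ 1 = u * v" "hartogs_cover k (u, v) $ 2 = v ^ k"
  by (simp_all add: hartogs_cover_def)

lemma measurable_hartogs_cover [measurable]: "hartogs_cover k \<in> lborel \<Otimes>\<^sub>M lborel \<rightarrow>\<^sub>M borel"
  unfolding hartogs_cover_def by measurable

text \<open>The complex Jacobian determinant of \<open>(u, v) \<mapsto> (u v, v\<^sup>k)\<close> is \<open>k v\<^sup>k\<close>, its real one
\<open>k\<^sup>2 \<bar>v\<bar>\<^bsup>2k\<^esup>\<close>; every point is hit \<open>k\<close> times, whence the weight \<open>k \<bar>v\<bar>\<^bsup>2k\<^esup>\<close>. The map has triangular shape,
so the formula follows from the power map in \<open>v\<close> and a scaling of each fibre in \<open>u\<close>.\<close>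

lemma nn_integral_hartogs_cover:
  assumes [measurable]: "f \<in> borel_measurable borel" and k: "k \<ge> 1"
  shows "(\<integral>\<^sup>+w. f w * indicator {w. cmod (w $ 2) \<le> 1} w \<partial>lborel)
    = (\<integral>\<^sup>+p. f (hartogs_cover k p) * ennreal (real k * cmod (snd p) ^ (2 * k) * indicator (cball 0 1) (snd p))
        \<partial>(lborel \<Otimes>\<^sub>M lborel))"
proof -
  define H where "H = (\<lambda>w2. \<integral>\<^sup>+w1. f (pair_vec (w1, w2)) \<partial>lborel)"
  have H[measurable]: "H \<in> borel_measurable borel" unfolding H_def by measurable
  have m2[measurable]: "{w::complex^2. cmod (w $ 2) \<le> 1} \<in> sets borel"
    by (intro borel_closed closed_Collect_le continuous_intros)
  have cb[measurable]: "cball (0::complex) 1 \<in> sets borel" by simp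
  have Hk: "H (v ^ k) * ennreal (real k * cmod v ^ (2 * (k - 1)))
      = (\<integral>\<^sup>+u. f (hartogs_cover k (u, v)) * ennreal (real k * cmod v ^ (2 * k)) \<partial>lborel)" if "v \<noteq> 0" for v
  proof -
    let ?I = "\<integral>\<^sup>+u. f (hartogs_cover k (u, v)) \<partial>lborel"
    have "(cmod v)\<^sup>2 * (real k * cmod v ^ (2 * (k - 1))) = real k * cmod v ^ (2 * k)"
      using k by (cases k) (auto simp: power_add power2_eq_square)
    then have e: "ennreal ((cmod v)\<^sup>2) * ennreal (real k * cmod v ^ (2 * (k - 1))) = ennreal (real k * cmod v ^ (2 * k))"
      by (subst ennreal_mult[symmetric]) auto
    have "H (v ^ k) = ennreal ((cmod v)\<^sup>2) * ?I"
      unfolding H_def using that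
      by (subst nn_integral_complex_mult[of v]) (auto simp: hartogs_cover_def mult.commute)
    then have "H (v ^ k) * ennreal (real k * cmod v ^ (2 * (k - 1)))
        = ?I * (ennreal ((cmod v)\<^sup>2) * ennreal (real k * cmod v ^ (2 * (k - 1))))"
      by (simp only: mult_ac)
    also have "\<dots> = (\<integral>\<^sup>+u. f (hartogs_cover k (u, v)) * ennreal (real k * cmod v ^ (2 * k)) \<partial>lborel)"
      unfolding e by (rule nn_integral_multc[symmetric]) measurable
    finally show ?thesis .
  qed
  have "(\<integral>\<^sup>+w. f w * indicator {w. cmod (w $ 2) \<le> 1} w \<partial>lborel)
      = (\<integral>\<^sup>+p. f (pair_vec p) * indicator (cball 0 1) (snd p) \<partial>(lborel \<Otimes>\<^sub>M lborel))"
    unfolding lborel_vec2_eq_distr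
    by (subst nn_integral_distr, measurable) (auto intro!: nn_integral_cong simp: indicator_def)
  also have "\<dots> = (\<integral>\<^sup>+w2. (\<integral>\<^sup>+w1. f (pair_vec (w1, w2)) * indicator (cball 0 1) w2 \<partial>lborel) \<partial>lborel)"
    by (subst lborel_pair.nn_integral_snd[symmetric]) auto
  also have "\<dots> = (\<integral>\<^sup>+w2. H w2 * indicator (cball 0 1) w2 \<partial>lborel)"
    unfolding H_def by (intro nn_integral_cong nn_integral_multc) measurable
  also have "\<dots> = (\<integral>\<^sup>+v. H (v ^ k) * ennreal (real k * cmod v ^ (2 * (k - 1))) * indicator (cball 0 1) v \<partial>lborel)"
    using k by (intro nn_integral_power_disc) auto
  also have "\<dots> = (\<integral>\<^sup>+v. (\<integral>\<^sup>+u. f (hartogs_cover k (u, v)) * ennreal (real k * cmod v ^ (2 * k) * indicator (cball 0 1) v) \<partial>lborel) \<partial>lborel)"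
  proof (rule nn_integral_cong_AE)
    show "AE v in lborel. H (v ^ k) * ennreal (real k * cmod v ^ (2 * (k - 1))) * indicator (cball 0 1) v
      = (\<integral>\<^sup>+u. f (hartogs_cover k (u, v)) * ennreal (real k * cmod v ^ (2 * k) * indicator (cball 0 1) v) \<partial>lborel)"
      using AE_lborel_singleton[of "0::complex"]
    proof eventually_elim
      case (elim v)
      show ?case using Hk[OF elim] by (cases "v \<in> cball 0 1") auto
    qed
  qed
  also have "\<dots> = (\<integral>\<^sup>+p. f (hartogs_cover k p) * ennreal (real k * cmod (snd p) ^ (2 * k) * indicator (cball 0 1) (snd p))
        \<partial>(lborel \<Otimes>\<^sub>M lborel))"
    by (subst lborel_pair.nn_integral_snd[symmetric]) auto
  finally show ?thesis .
qed

text \<open>The same formula as an identity of measures, to be used for complex-valued integrands.\<close>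

lemma density_lborel_eq_distr_hartogs_cover:
  assumes k: "k \<ge> 1"
  shows "density lborel (\<lambda>w. indicator {w::complex^2. cmod (w $ 2) \<le> 1} w)
    = distr (density (lborel \<Otimes>\<^sub>M lborel)
        (\<lambda>p. ennreal (real k * cmod (snd p) ^ (2 * k) * indicator (cball 0 1) (snd p)))) borel (hartogs_cover k)"
  (is "?M = ?N")
proof (rule measure_eqI)
  have m2[measurable]: "{w::complex^2. cmod (w $ 2) \<le> 1} \<in> sets borel"
    by (intro borel_closed closed_Collect_le continuous_intros)
  have cb[measurable]: "cball (0::complex) 1 \<in> sets borel" by simp
  fix A assume "A \<in> sets ?M"
  then have [measurable]: "A \<in> sets borel" by simp
  have "emeasure ?M A = (\<integral>\<^sup>+w. indicator A w * indicator {w::complex^2. cmod (w $ 2) \<le> 1} w \<partial>lborel)"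
    by (subst emeasure_density) (auto simp: mult.commute)
  also have "\<dots> = (\<integral>\<^sup>+p. indicator A (hartogs_cover k p) * ennreal (real k * cmod (snd p) ^ (2 * k) * indicator (cball 0 1) (snd p))
        \<partial>(lborel \<Otimes>\<^sub>M lborel))"
    using k by (intro nn_integral_hartogs_cover) auto
  also have "\<dots> = (\<integral>\<^sup>+w. indicator A w \<partial>?N)"
    by (subst nn_integral_distr, measurable, subst nn_integral_density) (auto simp: mult.commute)
  also have "\<dots> = emeasure ?N A"
    by (rule nn_integral_indicator) simp
  finally show "emeasure ?M A = emeasure ?N A" .
qed simp

section \<open>The Bergman kernel of the disc\<close>

text \<open>On sets of finite measure, this turns square integrability into integrability.\<close>

lemma le_one_plus_power2: "x \<le> 1 + x\<^sup>2" for x :: real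
  using zero_le_power2[of "2 * x - 1"] by (simp add: power2_eq_square algebra_simps)

text \<open>Cauchy's formula for the derivatives at the centre, written out on the circle of radius \<open>r\<close>.\<close>

lemma has_integral_circle_Taylor_coeff:
  fixes h :: "complex \<Rightarrow> complex"
  assumes hol: "h holomorphic_on ball 0 \<rho>" and r: "0 < r" "r < \<rho>"
  shows "((\<lambda>\<theta>. h (of_real r * cis \<theta>) * cnj (cis \<theta>) ^ m) has_integral
     (2 * pi * r ^ m * ((deriv ^^ m) h 0 / fact m))) {0..2*pi}"
proof -
  have "((\<lambda>u. h u / (u - 0) ^ Suc m) has_contour_integral (2 * pi * \<i>) / fact m * (deriv ^^ m) h 0) (circlepath 0 r)"
    using r by (intro Cauchy_has_contour_integral_higher_derivative_circlepath
        holomorphic_on_imp_continuous_on holomorphic_on_subset[OF hol]) auto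
  then have "((\<lambda>t. h (0 + r * cis t) / (0 + r * cis t - 0) ^ Suc m * r * \<i> * cis t) has_integral
      (2 * pi * \<i>) / fact m * (deriv ^^ m) h 0) {0..2*pi}"
    unfolding circlepath_def by (subst (asm) has_contour_integral_part_circlepath_iff) auto
  from has_integral_mult_right[OF this, of "of_real (r ^ m) / \<i>"]
  have "((\<lambda>t. of_real (r ^ m) / \<i> * (h (0 + r * cis t) / (0 + r * cis t - 0) ^ Suc m * r * \<i> * cis t)) has_integral
      (2 * pi * r ^ m * ((deriv ^^ m) h 0 / fact m))) {0..2*pi}"
    by (simp add: mult_ac)
  moreover have "of_real (r ^ m) / \<i> * (h (0 + r * cis t) / (0 + r * cis t - 0) ^ Suc m * r * \<i> * cis t)
      = h (of_real r * cis t) * cnj (cis t) ^ m" for t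
  proof -
    define c where "c = cis t"
    have "c \<noteq> 0" "cnj c = inverse c" by (simp_all add: c_def cis_cnj)
    then have "c ^ m * cnj c ^ m = 1" by (simp add: power_mult_distrib[symmetric])
    with \<open>c \<noteq> 0\<close> show ?thesis
      unfolding c_def[symmetric] using r by (simp add: power_mult_distrib field_simps)
  qed
  ultimately show ?thesis by simp
qed

text \<open>Powers of \<open>w\<close> are orthogonal on discs, so pairing with \<open>w\<^sup>m\<close> extracts the Taylor coefficient of order \<open>m\<close>.
In polar coordinates the angular integral is Cauchy's formula, and Fubini's theorem applies because \<open>h\<close> is integrable.\<close>

lemma set_integral_disc_Taylor_coeff:
  assumes hol: "h holomorphic_on ball 0 \<rho>" and int: "set_integrable lborel (ball 0 \<rho>) h" and \<rho>: "0 < \<rho>"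
  shows "(LINT w:ball 0 \<rho>|lborel. h w * cnj w ^ m)
    = of_real (pi * \<rho> ^ (2 * m + 2) / real (m + 1)) * ((deriv ^^ m) h 0 / fact m)"
proof -
  define a where "a = (deriv ^^ m) h 0 / fact m"
  define F where "F = (\<lambda>w. indicator (ball 0 \<rho>) w *\<^sub>R (h w * cnj w ^ m))"
  define d where "d = (\<lambda>p::real\<times>real. (fst p * indicator {0..} (fst p)) * indicator {0..<2*pi} (snd p) :: real)"
  have [measurable]: "ball (0::complex) \<rho> \<in> sets borel" by auto
  have [measurable]: "d \<in> borel_measurable (lborel \<Otimes>\<^sub>M lborel)" unfolding d_def by measurable
  have d0: "d p \<ge> 0" for p by (auto simp: d_def indicator_def)
  have F[measurable]: "F \<in> borel_measurable borel"
    unfolding F_def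
    by (intro borel_measurable_continuous_on_indicator continuous_intros holomorphic_on_imp_continuous_on hol) auto
  have "integrable lborel F"
  proof (rule Bochner_Integration.integrable_bound)
    show "integrable lborel (\<lambda>w. \<rho> ^ m *\<^sub>R (indicator (ball 0 \<rho>) w *\<^sub>R h w))"
      using int unfolding set_integrable_def by (rule integrable_scaleR_right)
    have "cmod h' * cmod w ^ m \<le> \<rho> ^ m * cmod h'" if "cmod w < \<rho>" for w h' :: complex
      using that power_mono[of "cmod w" \<rho> m] by (subst mult.commute) (intro mult_right_mono, auto)
    then show "AE w in lborel. norm (F w) \<le> norm (\<rho> ^ m *\<^sub>R (indicator (ball 0 \<rho>) w *\<^sub>R h w))"
      using \<rho> by (auto simp: F_def indicator_def norm_mult norm_power)
  qed simp
  moreover have polar: "(lborel :: complex measure) = distr (density (lborel \<Otimes>\<^sub>M lborel) (\<lambda>p. ennreal (d p))) borel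
      (\<lambda>p. of_real (fst p) * cis (snd p))"
    unfolding d_def by (rule lborel_eq_distr_polar)
  moreover have "integrable (distr (density (lborel \<Otimes>\<^sub>M lborel) (\<lambda>p. ennreal (d p))) borel
      (\<lambda>p. of_real (fst p) * cis (snd p))) F
      \<longleftrightarrow> integrable (lborel \<Otimes>\<^sub>M lborel) (\<lambda>p. d p *\<^sub>R F (of_real (fst p) * cis (snd p)))"
    by (subst integrable_distr_eq, measurable, subst integrable_density) (use d0 in auto)
  ultimately have int2: "integrable (lborel \<Otimes>\<^sub>M lborel) (\<lambda>p. d p *\<^sub>R F (of_real (fst p) * cis (snd p)))"
    by simp
  have "integral\<^sup>L (distr (density (lborel \<Otimes>\<^sub>M lborel) (\<lambda>p. ennreal (d p))) borel
      (\<lambda>p. of_real (fst p) * cis (snd p))) F = integral\<^sup>L (lborel \<Otimes>\<^sub>M lborel) (\<lambda>p. d p *\<^sub>R F (of_real (fst p) * cis (snd p)))"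
    by (subst integral_distr, measurable, subst integral_density) (use d0 in auto)
  then have eq: "integral\<^sup>L lborel F = integral\<^sup>L (lborel \<Otimes>\<^sub>M lborel) (\<lambda>p. d p *\<^sub>R F (of_real (fst p) * cis (snd p)))"
    using polar by simp
  have inner: "(LINT \<theta>|lborel. d (r, \<theta>) *\<^sub>R F (of_real r * cis \<theta>))
      = indicator {0..\<rho>} r *\<^sub>R (of_real (2 * pi * r ^ (2 * m + 1)) * a)" if "r \<noteq> \<rho>" for r
  proof (cases "0 < r \<and> r < \<rho>")
    case True
    then have sub: "of_real r * cis \<theta> \<in> ball 0 \<rho>" for \<theta> by (simp add: norm_mult)
    have I: "((\<lambda>\<theta>. h (of_real r * cis \<theta>) * cnj (cis \<theta>) ^ m) has_integral
       (2 * pi * r ^ m * a)) {0..2*pi}"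
      unfolding a_def using True by (intro has_integral_circle_Taylor_coeff[OF hol]) auto
    have cont: "continuous_on {0..2*pi} (\<lambda>\<theta>. h (of_real r * cis \<theta>) * cnj (cis \<theta>) ^ m)"
      using sub by (intro continuous_intros continuous_on_compose2[OF holomorphic_on_imp_continuous_on[OF hol]]) auto
    then have m: "(\<lambda>\<theta>. indicator {0..2*pi} \<theta> *\<^sub>R (h (of_real r * cis \<theta>) * cnj (cis \<theta>) ^ m)) \<in> borel_measurable lborel"
      unfolding measurable_lborel2 by (intro borel_measurable_continuous_on_indicator) simp
    from cont I have "(LINT \<theta>:{0..2*pi}|lborel. h (of_real r * cis \<theta>) * cnj (cis \<theta>) ^ m) = 2 * pi * r ^ m * a"
      by (subst set_borel_integral_eq_integral)
         (auto intro: borel_integrable_atLeastAtMost' simp: integral_unique[OF I])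
    moreover have "(LINT \<theta>|lborel. d (r, \<theta>) *\<^sub>R F (of_real r * cis \<theta>))
        = (LINT \<theta>|lborel. of_real (r ^ (m + 1)) * (indicator {0..2*pi} \<theta> *\<^sub>R (h (of_real r * cis \<theta>) * cnj (cis \<theta>) ^ m)))"
    proof (rule integral_cong_AE)
      show "AE \<theta> in lborel. d (r, \<theta>) *\<^sub>R F (of_real r * cis \<theta>)
          = of_real (r ^ (m + 1)) * (indicator {0..2*pi} \<theta> *\<^sub>R (h (of_real r * cis \<theta>) * cnj (cis \<theta>) ^ m))"
        using AE_lborel_singleton[of "2 * pi"]
        by eventually_elim
           (use True sub in \<open>auto simp: d_def F_def indicator_def scaleR_conv_of_real power_mult_distrib\<close>)
      show "(\<lambda>\<theta>. of_real (r ^ (m + 1)) * (indicator {0..2*pi} \<theta> *\<^sub>R (h (of_real r * cis \<theta>) * cnj (cis \<theta>) ^ m))) \<in> borel_measurable lborel"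
        by (rule borel_measurable_times[OF borel_measurable_const m])
    qed measurable
    ultimately have "(LINT \<theta>|lborel. d (r, \<theta>) *\<^sub>R F (of_real r * cis \<theta>))
        = of_real (r ^ (m + 1)) * (2 * pi * r ^ m * a)"
      by (simp only: set_lebesgue_integral_def integral_mult_right_zero)
    moreover have "r ^ (2 * m + 1) = r ^ (m + 1) * r ^ m"
      by (simp add: power_add[symmetric] mult_2)
    ultimately show ?thesis
      using True by simp
  next
    case False
    then have e: "(\<lambda>\<theta>. d (r, \<theta>) *\<^sub>R F (of_real r * cis \<theta>)) = (\<lambda>\<theta>. 0)"
      using that by (auto simp: d_def F_def indicator_def norm_mult fun_eq_iff)
    show ?thesis unfolding e using False that by (auto simp: indicator_def)
  qed
  have "(LINT w:ball 0 \<rho>|lborel. h w * cnj w ^ m) = integral\<^sup>L lborel F"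
    by (simp add: set_lebesgue_integral_def F_def)
  also have "\<dots> = (LINT r|lborel. LINT \<theta>|lborel. d (r, \<theta>) *\<^sub>R F (of_real r * cis \<theta>))"
    unfolding eq lborel_pair.integral_fst'[OF int2, symmetric] by simp
  also have "\<dots> = (LINT r|lborel. indicator {0..\<rho>} r *\<^sub>R (of_real (2 * pi * r ^ (2 * m + 1)) * a))"
  proof (rule integral_cong_AE)
    show "AE r in lborel. (LINT \<theta>|lborel. d (r, \<theta>) *\<^sub>R F (of_real r * cis \<theta>))
        = indicator {0..\<rho>} r *\<^sub>R (of_real (2 * pi * r ^ (2 * m + 1)) * a)"
      using AE_lborel_singleton[of \<rho>] by eventually_elim (rule inner)
  qed measurable
  also have "\<dots> = of_real (2 * pi * \<rho> ^ (2 * m + 2) / real (2 * m + 2)) * a - of_real (2 * pi * 0 ^ (2 * m + 2) / real (2 * m + 2)) * a"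
  proof (rule integral_FTC_atLeastAtMost)
    show "((\<lambda>r. of_real (2 * pi * r ^ (2 * m + 2) / real (2 * m + 2)) * a) has_vector_derivative
        of_real (2 * pi * r ^ (2 * m + 1)) * a) (at r within {0..\<rho>})" for r
    proof -
      have "((\<lambda>r. 2 * pi * r ^ (2 * m + 2) / real (2 * m + 2)) has_real_derivative 2 * pi * r ^ (2 * m + 1)) (at r within {0..\<rho>})"
        by (rule derivative_eq_intros refl | simp)+
      then have "((\<lambda>r. of_real (2 * pi * r ^ (2 * m + 2) / real (2 * m + 2)) :: complex) has_vector_derivative
          of_real (2 * pi * r ^ (2 * m + 1))) (at r within {0..\<rho>})"
        by (intro has_vector_derivative_of_real) (simp add: has_real_derivative_iff_has_vector_derivative)
      then show ?thesis by (rule has_vector_derivative_mult_left)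
    qed
  qed (use \<rho> in \<open>auto intro!: continuous_intros\<close>)
  also have "\<dots> = of_real (pi * \<rho> ^ (2 * m + 2) / real (m + 1)) * a"
  proof -
    have "2 * pi * \<rho> ^ (2 * m + 2) / real (2 * m + 2) = pi * \<rho> ^ (2 * m + 2) / real (m + 1)"
      by (simp add: field_simps)
    then show ?thesis by simp
  qed
  finally show ?thesis by (simp add: a_def)
qed

text \<open>The mean value property is applied to the holomorphic function \<open>h\<^sup>2\<close>; this bounds point values
by square means.\<close>

lemma mean_value_square_le:
  assumes hol: "h holomorphic_on ball a r" and r: "0 < r"
  shows "ennreal (pi * r\<^sup>2 * (cmod (h a))\<^sup>2) \<le> (\<integral>\<^sup>+w. ennreal ((cmod (h w))\<^sup>2) * indicator (ball a r) w \<partial>lborel)"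
proof (cases "(\<integral>\<^sup>+w. ennreal ((cmod (h w))\<^sup>2) * indicator (ball a r) w \<partial>lborel) < \<infinity>")
  case True
  define H where "H = (\<lambda>w. indicator (ball a r) w *\<^sub>R (h w)\<^sup>2)"
  have H[measurable]: "H \<in> borel_measurable borel"
    unfolding H_def
    by (intro borel_measurable_continuous_on_indicator continuous_intros holomorphic_on_imp_continuous_on hol) auto
  have nH: "(\<integral>\<^sup>+w. ennreal (norm (H w)) \<partial>lborel) = (\<integral>\<^sup>+w. ennreal ((cmod (h w))\<^sup>2) * indicator (ball a r) w \<partial>lborel)"
    by (intro nn_integral_cong) (auto simp: H_def indicator_def norm_power)
  have int: "integrable lborel H"
    using True nH by (intro integrableI_bounded) auto
  have sh: "(lborel :: complex measure) = distr lborel borel (\<lambda>w. a + w)"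
    using lborel_affine[of 1 a] by (simp add: density_1)
  have hol': "(\<lambda>w. (h (a + w))\<^sup>2) holomorphic_on ball 0 r"
    by (intro holomorphic_intros holomorphic_on_compose_gen[OF _ hol, unfolded o_def]) (auto simp: dist_norm)
  have H': "H (a + w) = indicator (ball 0 r) w *\<^sub>R (h (a + w))\<^sup>2" for w
    by (auto simp: H_def indicator_def dist_norm)
  have "integrable lborel (\<lambda>w. H (a + w))"
    using int by (subst (asm) sh, subst (asm) integrable_distr_eq) auto
  then have int': "set_integrable lborel (ball 0 r) (\<lambda>w. (h (a + w))\<^sup>2)"
    by (simp add: set_integrable_def H')
  have "integral\<^sup>L lborel H = (LINT w|lborel. H (a + w))"
    by (subst sh, subst integral_distr) auto
  also have "\<dots> = of_real (pi * r\<^sup>2) * (h a)\<^sup>2"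
    using set_integral_disc_Taylor_coeff[OF hol' int' r, of 0]
    by (simp add: set_lebesgue_integral_def H' power2_eq_square)
  finally have "cmod (of_real (pi * r\<^sup>2) * (h a)\<^sup>2) \<le> (LINT w|lborel. norm (H w))"
    using integral_norm_bound[of lborel H] by simp
  then have "pi * r\<^sup>2 * (cmod (h a))\<^sup>2 \<le> (LINT w|lborel. norm (H w))"
    by (simp add: norm_mult norm_power)
  then have "ennreal (pi * r\<^sup>2 * (cmod (h a))\<^sup>2) \<le> ennreal (LINT w|lborel. norm (H w))"
    by (rule ennreal_leI)
  also have "\<dots> = (\<integral>\<^sup>+w. ennreal (norm (H w)) \<partial>lborel)"
    using int by (subst nn_integral_eq_integral) auto
  finally show ?thesis unfolding nH .
next
  case False
  then show ?thesis by (simp add: less_top[symmetric])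
qed

text \<open>By the mean value inequality on the disc of radius \<open>\<bar>w\<bar>\<close> about \<open>w\<close>, which avoids the origin, \<open>\<bar>w h(w)\<bar>\<^sup>2\<close> is
at most the mass of \<open>\<bar>h\<bar>\<^sup>2\<close> near the origin, up to a constant. This mass tends to \<open>0\<close>, so
\<open>w h(w)\<close> does too and Riemann's theorem applies.\<close>

lemma removable_singularity_square_integrable:
  assumes hol: "h holomorphic_on ball 0 1 - {0}"
    and fin: "(\<integral>\<^sup>+w. ennreal ((cmod (h w))\<^sup>2) * indicator (ball 0 1) w \<partial>lborel) < \<infinity>"
  obtains g where "g holomorphic_on ball 0 1" "\<And>w. w \<in> ball 0 1 - {0} \<Longrightarrow> g w = h w"
proof -
  define h' where "h' = (\<lambda>w. indicator (ball 0 1 - {0}) w *\<^sub>R h w)"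
  have h'[measurable]: "h' \<in> borel_measurable borel"
    unfolding h'_def
    by (intro borel_measurable_continuous_on_indicator holomorphic_on_imp_continuous_on hol) auto
  define N where "N = density lborel (\<lambda>w. ennreal ((cmod (h' w))\<^sup>2))"
  define A where "A = (\<lambda>n. ball (0::complex) (1 / real (Suc n)))"
  have "(\<lambda>n. emeasure N (A n)) \<longlonglongrightarrow> emeasure N (\<Inter>n. A n)"
  proof (rule Lim_emeasure_decseq)
    show "range A \<subseteq> sets N" by (auto simp: A_def N_def)
    show "decseq A"
      unfolding decseq_Suc_iff A_def by (intro allI subset_ball) (simp add: frac_le)
    fix n
    have "emeasure N (A n) \<le> emeasure N UNIV"
      by (rule emeasure_mono) (auto simp: N_def)
    also have "\<dots> \<le> (\<integral>\<^sup>+w. ennreal ((cmod (h w))\<^sup>2) * indicator (ball 0 1) w \<partial>lborel)"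
      unfolding N_def by (subst emeasure_density, measurable) (auto intro!: nn_integral_mono simp: h'_def indicator_def)
    finally show "emeasure N (A n) \<noteq> \<infinity>" using fin by auto
  qed
  moreover have "(\<Inter>n. A n) = {0}"
  proof -
    have "w = 0" if "\<And>n. cmod w < 1 / real (Suc n)" for w :: complex
    proof (rule ccontr)
      assume "w \<noteq> 0"
      then obtain n where "inverse (real (Suc n)) < cmod w" using reals_Archimedean[of "cmod w"] by auto
      with that[of n] show False by (simp add: inverse_eq_divide)
    qed
    then show ?thesis by (auto simp: A_def)
  qed
  moreover have "emeasure N {0} = 0"
    unfolding N_def by (simp add: emeasure_density nn_integral_indicator_singleton)
  ultimately have lim: "(\<lambda>n. emeasure N (A n)) \<longlonglongrightarrow> 0" by simp
  have "((\<lambda>w. (w - 0) * h w) \<longlongrightarrow> 0) (at 0)"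
  proof (rule tendstoI)
    fix e :: real assume e: "0 < e"
    then have "\<forall>\<^sub>F n in sequentially. emeasure N (A n) < ennreal (pi * e\<^sup>2)"
      using lim by (intro order_tendstoD(2)) auto
    then obtain n where n: "emeasure N (A n) < ennreal (pi * e\<^sup>2)"
      by (auto simp: eventually_sequentially)
    show "\<forall>\<^sub>F w in at 0. dist ((w - 0) * h w) 0 < e"
      unfolding eventually_at
    \<comment> \<open>Half the radius of the small disc, since the disc about \<open>w\<close> reaches out to \<open>2 \<bar>w\<bar>\<close>.\<close>
    proof (intro exI[of _ "1 / (2 * real (Suc n))"] conjI ballI impI)
      fix w :: complex
      assume w: "w \<noteq> 0 \<and> dist w 0 < 1 / (2 * real (Suc n))"
      have sub: "ball w (cmod w) \<subseteq> A n - {0}"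
      proof
        fix x assume x: "x \<in> ball w (cmod w)"
        have "cmod x \<le> cmod w + cmod (w - x)"
          using norm_triangle_ineq4[of w "w - x"] by simp
        also have "\<dots> < 2 * cmod w" using x by (simp add: dist_norm)
        also have "\<dots> < 1 / real (Suc n)" using w by (simp add: field_simps)
        finally show "x \<in> A n - {0}" using x by (auto simp: A_def dist_norm)
      qed
      have A1: "A n \<subseteq> ball 0 1" unfolding A_def by (intro subset_ball) simp
      have "ennreal (pi * (cmod w)\<^sup>2 * (cmod (h w))\<^sup>2) \<le> (\<integral>\<^sup>+x. ennreal ((cmod (h x))\<^sup>2) * indicator (ball w (cmod w)) x \<partial>lborel)"
        using w sub A1 by (intro mean_value_square_le holomorphic_on_subset[OF hol]) auto
      also have "\<dots> \<le> (\<integral>\<^sup>+x. ennreal ((cmod (h' x))\<^sup>2) * indicator (A n) x \<partial>lborel)"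
      proof (rule nn_integral_mono)
        fix x
        show "ennreal ((cmod (h x))\<^sup>2) * indicator (ball w (cmod w)) x \<le> ennreal ((cmod (h' x))\<^sup>2) * indicator (A n) x"
        proof (cases "x \<in> ball w (cmod w)")
          case True
          then have "x \<in> A n" "x \<in> ball 0 1 - {0}" using sub A1 by blast+
          then show ?thesis using True by (simp add: h'_def)
        qed simp
      qed
      also have "\<dots> = emeasure N (A n)"
        unfolding N_def by (subst emeasure_density) (auto simp: A_def simp del: indicator_simps)
      also note n
      finally have "(cmod w * cmod (h w))\<^sup>2 < e\<^sup>2"
        by (simp add: ennreal_less_iff power_mult_distrib mult.assoc)
      then show "dist ((w - 0) * h w) 0 < e"
        using e by (simp add: norm_mult power2_less_imp_less)
    qed simp
  qed
  then obtain g where "g holomorphic_on ball 0 1" "\<forall>w\<in>ball 0 1 - {0}. g w = h w"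
    using holomorphic_on_extend_lim[OF hol] by auto
  then show thesis using that by blast
qed

text \<open>The Bergman kernel of the unit disc. Since \<open>\<bar>z\<bar> < 1\<close> is fixed, the expansion
\<open>1 / (1 - z w\<^sup>*)\<^sup>2 = \<Sum>\<^sub>m (m + 1) (z w\<^sup>*)\<^sup>m\<close> (with \<open>w\<^sup>*\<close> the conjugate of \<open>w\<close>) converges uniformly on the whole disc and may be
integrated term by term against the integrable function \<open>g\<close>; the terms add up to the Taylor series of \<open>g\<close>.\<close>

lemma disc_reproducing:
  assumes g: "g holomorphic_on ball 0 1"
    and fin: "(\<integral>\<^sup>+w. ennreal ((cmod (g w))\<^sup>2) * indicator (ball 0 1) w \<partial>lborel) < \<infinity>"
    and z: "z \<in> ball 0 1"
  shows "(LINT w:ball 0 1|lborel. g w / (1 - z * cnj w)\<^sup>2) = of_real pi * g z"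
proof -
  define G where "G = (\<lambda>w. indicator (ball 0 1) w *\<^sub>R g w)"
  have G[measurable]: "G \<in> borel_measurable borel"
    unfolding G_def
    by (intro borel_measurable_continuous_on_indicator holomorphic_on_imp_continuous_on g) auto
  have intG: "integrable lborel G"
  proof (rule integrableI_bounded)
    have "(\<integral>\<^sup>+w. ennreal (norm (G w)) \<partial>lborel)
        \<le> (\<integral>\<^sup>+w. indicator (ball 0 1) w + ennreal ((cmod (G w))\<^sup>2) \<partial>lborel)"
    proof (rule nn_integral_mono)
      fix w
      show "ennreal (norm (G w)) \<le> indicator (ball 0 1) w + ennreal ((cmod (G w))\<^sup>2)"
        using ennreal_leI[OF le_one_plus_power2[of "cmod (G w)"]]
        by (cases "w \<in> ball 0 1") (auto simp: G_def)
    qed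
    also have "\<dots> = emeasure lborel (ball (0::complex) 1) + (\<integral>\<^sup>+w. ennreal ((cmod (G w))\<^sup>2) \<partial>lborel)"
      by (subst nn_integral_add) (auto intro!: borel_measurable_indicator)
    also have "(\<integral>\<^sup>+w. ennreal ((cmod (G w))\<^sup>2) \<partial>lborel)
        = (\<integral>\<^sup>+w. ennreal ((cmod (g w))\<^sup>2) * indicator (ball 0 1) w \<partial>lborel)"
      by (intro nn_integral_cong) (auto simp: G_def indicator_def)
    also have "emeasure lborel (ball (0::complex) 1) + \<dots> < \<infinity>"
      using fin by (simp add: emeasure_ball)
    finally show "(\<integral>\<^sup>+w. ennreal (norm (G w)) \<partial>lborel) < \<infinity>" .
  qed simp
  let ?a = "\<lambda>m. (deriv ^^ m) g 0 / fact m"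
  let ?t = "\<lambda>m w. (of_nat (Suc m) * z ^ m) * (indicator (ball 0 1) w *\<^sub>R (g w * cnj w ^ m))"
  have le: "cmod (indicator (ball 0 1) w *\<^sub>R (g w * cnj w ^ m)) \<le> norm (G w)" for m w
    by (auto simp: G_def indicator_def norm_mult norm_power intro!: mult_left_le power_le_one)
  have le2: "norm (?t m w) \<le> norm (of_nat (Suc m) * z ^ m) * norm (G w)" for m w
    unfolding norm_mult[of "of_nat (Suc m) * z ^ m"] by (intro mult_left_mono le norm_ge_zero)
  have m1: "(\<lambda>w. indicator (ball 0 1) w *\<^sub>R (g w * cnj w ^ m)) \<in> borel_measurable borel" for m
    by (intro borel_measurable_continuous_on_indicator continuous_intros holomorphic_on_imp_continuous_on g) auto
  have int1: "integrable lborel (\<lambda>w. indicator (ball 0 1) w *\<^sub>R (g w * cnj w ^ m))" for m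
    by (rule Bochner_Integration.integrable_bound[OF intG]) (use m1 le in auto)
  have z1: "cmod z < 1" using z by simp
  have sums_norm: "summable (\<lambda>m. norm (of_nat (Suc m) * z ^ m))"
    unfolding norm_mult norm_of_nat norm_power
    using geometric_deriv_sums[of "cmod z"] z1 by (simp add: sums_iff del: of_nat_Suc)
  have "(\<lambda>m. integral\<^sup>L lborel (?t m)) sums (LINT w|lborel. (\<Sum>m. ?t m w))"
  proof (rule sums_integral)
    show "integrable lborel (?t m)" for m
      by (intro integrable_mult_right int1)
    show "AE w in lborel. summable (\<lambda>m. norm (?t m w))"
    proof (rule AE_I2)
      fix w
      show "summable (\<lambda>m. norm (?t m w))"
        by (rule summable_comparison_test'[OF summable_mult2[OF sums_norm, of "norm (G w)"], of 0])
           (use le2 in simp)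
    qed
    show "summable (\<lambda>m. LINT w|lborel. norm (?t m w))"
    proof (rule summable_comparison_test'[OF summable_mult2[OF sums_norm, of "LINT w|lborel. norm (G w)"], of 0])
      fix m :: nat
      have "(LINT w|lborel. norm (?t m w)) \<le> (LINT w|lborel. norm (of_nat (Suc m) * z ^ m) * norm (G w))"
        by (intro integral_mono integrable_norm integrable_mult_right int1 intG)
           (rule le2)
      then show "norm (LINT w|lborel. norm (?t m w)) \<le> norm (of_nat (Suc m) * z ^ m) * (LINT w|lborel. norm (G w))"
        by simp
    qed
  qed
  moreover have "integral\<^sup>L lborel (?t m) = of_real pi * (?a m * (z - 0) ^ m)" for m
  proof -
    have "integral\<^sup>L lborel (?t m) = of_nat (Suc m) * z ^ m * (LINT w:ball 0 1|lborel. g w * cnj w ^ m)"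
      unfolding set_lebesgue_integral_def by (rule integral_mult_right_zero)
    also have "(LINT w:ball 0 1|lborel. g w * cnj w ^ m) = of_real (pi * 1 ^ (2 * m + 2) / real (m + 1)) * ?a m"
      by (rule set_integral_disc_Taylor_coeff[OF g]) (use intG in \<open>auto simp: set_integrable_def G_def\<close>)
    finally show ?thesis by (simp add: field_simps del: of_nat_Suc)
  qed
  moreover have "(\<lambda>m. of_real pi * (?a m * (z - 0) ^ m)) sums (of_real pi * g z)"
    by (intro sums_mult holomorphic_power_series[OF g]) (use z in auto)
  moreover have "(\<Sum>m. ?t m w) = indicator (ball 0 1) w *\<^sub>R (g w / (1 - z * cnj w)\<^sup>2)" for w
  proof (cases "w \<in> ball 0 1")
    case True
    then have "cmod (z * cnj w) < 1"
      using z1 mult_left_mono[of "cmod w" 1 "cmod z"] by (simp add: norm_mult)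
    from sums_mult[OF geometric_deriv_sums[OF this], of "g w"]
    have "(\<lambda>m. g w * (of_nat (Suc m) * (z * cnj w) ^ m)) sums (g w / (1 - z * cnj w)\<^sup>2)" by simp
    moreover have "g w * (of_nat (Suc m) * (z * cnj w) ^ m) = ?t m w" for m
      using True by (simp add: power_mult_distrib mult_ac)
    ultimately show ?thesis using True by (simp add: sums_iff)
  next
    case False
    then show ?thesis by simp
  qed
  ultimately have "(\<lambda>m. of_real pi * (?a m * (z - 0) ^ m)) sums (LINT w:ball 0 1|lborel. g w / (1 - z * cnj w)\<^sup>2)"
      "(\<lambda>m. of_real pi * (?a m * (z - 0) ^ m)) sums (of_real pi * g z)"
    by (simp_all only: set_lebesgue_integral_def)
  then show ?thesis by (rule sums_unique2)
qed

lemma disc_reproducing_punctured: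
  assumes hol: "h holomorphic_on ball 0 1 - {0}"
    and fin: "(\<integral>\<^sup>+w. ennreal ((cmod (h w))\<^sup>2) * indicator (ball 0 1) w \<partial>lborel) < \<infinity>"
    and z: "z \<in> ball 0 1 - {0}"
  shows "(LINT w:ball 0 1|lborel. h w / (1 - z * cnj w)\<^sup>2) = of_real pi * h z"
proof -
  obtain g where g: "g holomorphic_on ball 0 1" and gh: "\<And>w. w \<in> ball 0 1 - {0} \<Longrightarrow> g w = h w"
    using removable_singularity_square_integrable[OF hol fin] by blast
  define G where "G = (\<lambda>w. indicator (ball 0 1) w *\<^sub>R g w)"
  have G[measurable]: "G \<in> borel_measurable borel"
    unfolding G_def
    by (intro borel_measurable_continuous_on_indicator holomorphic_on_imp_continuous_on g) auto
  have "(\<integral>\<^sup>+w. ennreal ((cmod (g w))\<^sup>2) * indicator (ball 0 1) w \<partial>lborel)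
      = (\<integral>\<^sup>+w. ennreal ((cmod (h w))\<^sup>2) * indicator (ball 0 1) w \<partial>lborel)"
  proof (rule nn_integral_cong_AE)
    show "AE w in lborel. ennreal ((cmod (g w))\<^sup>2) * indicator (ball 0 1) w
        = ennreal ((cmod (h w))\<^sup>2) * indicator (ball 0 1) w"
      using AE_lborel_singleton[of "0::complex"]
      by eventually_elim (use gh in \<open>auto simp: indicator_def\<close>)
  qed
  then have "(LINT w:ball 0 1|lborel. g w / (1 - z * cnj w)\<^sup>2) = of_real pi * g z"
    using fin z by (intro disc_reproducing g) auto
  moreover have "(LINT w:ball 0 1|lborel. h w / (1 - z * cnj w)\<^sup>2) = (LINT w:ball 0 1|lborel. g w / (1 - z * cnj w)\<^sup>2)"
    unfolding set_lebesgue_integral_def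
  proof (rule integral_cong_AE)
    have eq: "(\<lambda>w. indicator (ball 0 1) w *\<^sub>R (h w / (1 - z * cnj w)\<^sup>2))
        = (\<lambda>w. if w = 0 then h 0 else G w / (1 - z * cnj w)\<^sup>2)"
      using gh by (auto simp: G_def indicator_def fun_eq_iff)
    show "(\<lambda>w. indicator (ball 0 1) w *\<^sub>R (h w / (1 - z * cnj w)\<^sup>2)) \<in> borel_measurable lborel"
      unfolding eq by measurable
    have eq: "(\<lambda>w. indicator (ball 0 1) w *\<^sub>R (g w / (1 - z * cnj w)\<^sup>2))
        = (\<lambda>w. G w / (1 - z * cnj w)\<^sup>2)"
      by (auto simp: G_def indicator_def fun_eq_iff)
    show "(\<lambda>w. indicator (ball 0 1) w *\<^sub>R (g w / (1 - z * cnj w)\<^sup>2)) \<in> borel_measurable lborel"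
      unfolding eq by measurable
    show "AE w in lborel. indicator (ball 0 1) w *\<^sub>R (h w / (1 - z * cnj w)\<^sup>2)
        = indicator (ball 0 1) w *\<^sub>R (g w / (1 - z * cnj w)\<^sup>2)"
      using AE_lborel_singleton[of "0::complex"]
      by eventually_elim (use gh in \<open>auto simp: indicator_def\<close>)
  qed
  ultimately show ?thesis using gh[OF z] by simp
qed

section \<open>The bidisc and functions invariant under the deck transformations\<close>

text \<open>The kernel of the bidisc is the product of two kernels of the disc, and Fubini's theorem reduces
the claim to one variable at a time. For almost every \<open>v\<close> the slice \<open>g (\<cdot>, v)\<close> is square integrable, but in the
second variable the claim is needed for the particular slice \<open>g (\<eta>, \<cdot>)\<close>; the mean value inequality in the first variable
makes that slice square integrable. The factor in \<open>v\<close> is punctured because the covering degenerates at \<open>v = 0\<close>.\<close>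

lemma bidisc_reproducing:
  fixes g :: "complex \<times> complex \<Rightarrow> complex"
  assumes meas [measurable]: "g \<in> borel_measurable (lborel \<Otimes>\<^sub>M lborel)"
    and supp: "\<And>u v. (u, v) \<notin> ball 0 1 \<times> (ball 0 1 - {0}) \<Longrightarrow> g (u, v) = 0"
    and hol1: "\<And>v. v \<in> ball 0 1 - {0} \<Longrightarrow> (\<lambda>u. g (u, v)) holomorphic_on ball 0 1"
    and hol2: "\<And>u. u \<in> ball 0 1 \<Longrightarrow> (\<lambda>v. g (u, v)) holomorphic_on ball 0 1 - {0}"
    and int: "integrable (lborel \<Otimes>\<^sub>M lborel) g"
    and fin: "(\<integral>\<^sup>+p. ennreal ((cmod (g p))\<^sup>2) \<partial>(lborel \<Otimes>\<^sub>M lborel)) < \<infinity>"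
    and \<eta>: "\<eta> \<in> ball 0 1" and \<zeta>: "\<zeta> \<in> ball 0 1 - {0}"
    and intK: "integrable (lborel \<Otimes>\<^sub>M lborel) (\<lambda>p. g p / ((1 - \<eta> * cnj (fst p))\<^sup>2 * (1 - \<zeta> * cnj (snd p))\<^sup>2))"
  shows "(LINT p|(lborel \<Otimes>\<^sub>M lborel). g p / ((1 - \<eta> * cnj (fst p))\<^sup>2 * (1 - \<zeta> * cnj (snd p))\<^sup>2))
    = of_real (pi\<^sup>2) * g (\<eta>, \<zeta>)"
proof -
  define N where "N = (\<lambda>v. \<integral>\<^sup>+u. ennreal ((cmod (g (u, v)))\<^sup>2) \<partial>lborel)"
  have N[measurable]: "N \<in> borel_measurable borel" unfolding N_def by measurable
  have Nfin: "(\<integral>\<^sup>+v. N v \<partial>lborel) < \<infinity>"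
    using fin unfolding N_def by (subst (asm) lborel_pair.nn_integral_snd[symmetric]) auto
  have slice: "(LINT u|lborel. g (u, v) / ((1 - \<eta> * cnj u)\<^sup>2 * (1 - \<zeta> * cnj v)\<^sup>2))
      = of_real pi * (g (\<eta>, v) / (1 - \<zeta> * cnj v)\<^sup>2)" if "N v \<noteq> \<infinity>" for v
  proof (cases "v \<in> ball 0 1 - {0}")
    case True
    have ind: "indicator (ball 0 1) u *\<^sub>R (g (u, v) / (1 - \<eta> * cnj u)\<^sup>2) = g (u, v) / (1 - \<eta> * cnj u)\<^sup>2" for u
      using supp[of u v] by (cases "u \<in> ball 0 1") auto
    have "(\<integral>\<^sup>+u. ennreal ((cmod (g (u, v)))\<^sup>2) * indicator (ball 0 1) u \<partial>lborel) \<le> N v"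
      unfolding N_def by (intro nn_integral_mono) (auto simp: indicator_def)
    also have "N v < \<infinity>" using that by (simp add: less_top[symmetric])
    finally have "(LINT u:ball 0 1|lborel. g (u, v) / (1 - \<eta> * cnj u)\<^sup>2) = of_real pi * g (\<eta>, v)"
      by (intro disc_reproducing hol1 True \<eta>)
    then have "(LINT u|lborel. g (u, v) / (1 - \<eta> * cnj u)\<^sup>2) = of_real pi * g (\<eta>, v)"
      by (simp only: set_lebesgue_integral_def ind)
    moreover have "(LINT u|lborel. g (u, v) / ((1 - \<eta> * cnj u)\<^sup>2 * (1 - \<zeta> * cnj v)\<^sup>2))
        = (LINT u|lborel. g (u, v) / (1 - \<eta> * cnj u)\<^sup>2) / (1 - \<zeta> * cnj v)\<^sup>2"
      by (subst integral_divide_zero[symmetric]) simp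
    ultimately show ?thesis by simp
  next
    case False
    then have "g (u, v) = 0" for u by (intro supp) auto
    then show ?thesis by simp
  qed
  have "(LINT p|(lborel \<Otimes>\<^sub>M lborel). g p / ((1 - \<eta> * cnj (fst p))\<^sup>2 * (1 - \<zeta> * cnj (snd p))\<^sup>2))
      = (LINT v|lborel. LINT u|lborel. g (u, v) / ((1 - \<eta> * cnj u)\<^sup>2 * (1 - \<zeta> * cnj v)\<^sup>2))"
    using lborel_pair.integral_snd[of "\<lambda>u v. g (u, v) / ((1 - \<eta> * cnj u)\<^sup>2 * (1 - \<zeta> * cnj v)\<^sup>2)"] intK
    by (simp add: case_prod_beta')
  also have "\<dots> = (LINT v|lborel. of_real pi * (g (\<eta>, v) / (1 - \<zeta> * cnj v)\<^sup>2))"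
  proof (rule integral_cong_AE)
    have "AE v in lborel. N v \<noteq> \<infinity>"
      using Nfin by (intro nn_integral_PInf_AE) auto
    then show "AE v in lborel. (LINT u|lborel. g (u, v) / ((1 - \<eta> * cnj u)\<^sup>2 * (1 - \<zeta> * cnj v)\<^sup>2))
        = of_real pi * (g (\<eta>, v) / (1 - \<zeta> * cnj v)\<^sup>2)"
      by eventually_elim (rule slice)
  qed measurable
  also have "\<dots> = of_real pi * (LINT v:ball 0 1|lborel. g (\<eta>, v) / (1 - \<zeta> * cnj v)\<^sup>2)"
  proof -
    have ind: "indicator (ball 0 1) v *\<^sub>R (g (\<eta>, v) / (1 - \<zeta> * cnj v)\<^sup>2) = g (\<eta>, v) / (1 - \<zeta> * cnj v)\<^sup>2" for v
      using supp[of \<eta> v] by (cases "v \<in> ball 0 1") auto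
    show ?thesis unfolding set_lebesgue_integral_def ind by (rule integral_mult_right_zero)
  qed
  also have "(LINT v:ball 0 1|lborel. g (\<eta>, v) / (1 - \<zeta> * cnj v)\<^sup>2) = of_real pi * g (\<eta>, \<zeta>)"
  proof (rule disc_reproducing_punctured[OF hol2[OF \<eta>] _ \<zeta>])
    \<comment> \<open>The mean value inequality is used on the largest disc about \<open>\<eta>\<close> inside the unit disc.\<close>
    define r where "r = 1 - cmod \<eta>"
    have r: "0 < r" "ball \<eta> r \<subseteq> ball 0 1"
      using \<eta> by (simp_all add: r_def ball_subset_ball_iff)
    have le: "ennreal (pi * r\<^sup>2) * (ennreal ((cmod (g (\<eta>, v)))\<^sup>2) * indicator (ball 0 1) v) \<le> N v" for v
    proof (cases "v \<in> ball 0 1 - {0}")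
      case True
      have "ennreal (pi * r\<^sup>2 * (cmod (g (\<eta>, v)))\<^sup>2) \<le> (\<integral>\<^sup>+u. ennreal ((cmod (g (u, v)))\<^sup>2) * indicator (ball \<eta> r) u \<partial>lborel)"
        using r by (intro mean_value_square_le holomorphic_on_subset[OF hol1[OF True]]) auto
      also have "\<dots> \<le> N v"
        unfolding N_def by (intro nn_integral_mono) (auto simp: indicator_def)
      finally show ?thesis using True by (simp add: ennreal_mult)
    next
      case False
      then have "g (\<eta>, v) = 0" by (intro supp) auto
      then show ?thesis by simp
    qed
    have "ennreal (pi * r\<^sup>2) * (\<integral>\<^sup>+v. ennreal ((cmod (g (\<eta>, v)))\<^sup>2) * indicator (ball 0 1) v \<partial>lborel)
        = (\<integral>\<^sup>+v. ennreal (pi * r\<^sup>2) * (ennreal ((cmod (g (\<eta>, v)))\<^sup>2) * indicator (ball 0 1) v) \<partial>lborel)"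
      by (rule nn_integral_cmult[symmetric]) (auto intro!: borel_measurable_times_ennreal borel_measurable_indicator)
    also have "\<dots> \<le> (\<integral>\<^sup>+v. N v \<partial>lborel)" by (intro nn_integral_mono le)
    also note Nfin
    finally show "(\<integral>\<^sup>+v. ennreal ((cmod (g (\<eta>, v)))\<^sup>2) * indicator (ball 0 1) v \<partial>lborel) < \<infinity>"
      using r by (auto simp: ennreal_mult_less_top)
  qed
  finally show ?thesis by (simp add: power2_eq_square)
qed

text \<open>The part of the power series of \<open>1 / (1 - X)\<^sup>2\<close> with exponents congruent to \<open>n - 1\<close> modulo \<open>k\<close>, in closed form.\<close>

definition residue_part :: "nat \<Rightarrow> nat \<Rightarrow> complex \<Rightarrow> complex"
  where "residue_part k n X = X ^ (n - 1) * (of_nat n + of_nat (k - n) * X ^ k) / (1 - X ^ k)\<^sup>2"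

lemma one_minus_power_neq_0:
  fixes X :: complex
  assumes "cmod X < 1" "k \<ge> 1"
  shows "1 - X ^ k \<noteq> 0"
  using assms by (metis eq_iff_diff_eq_0 norm_one norm_power power_less_one_iff less_irrefl norm_ge_zero not_one_le_zero neq0_conv)

text \<open>Over the common denominator \<open>(1 - X\<^sup>k)\<^sup>2\<close> the numerators add up to \<open>A + X\<^sup>k (k S - A)\<close>, where \<open>A\<close> and \<open>S\<close> are the truncations to degree below \<open>k\<close> of the series of \<open>1 / (1 - X)\<^sup>2\<close> and
\<open>1 / (1 - X)\<close>; both have closed forms.\<close>

lemma sum_residue_part:
  assumes X: "cmod X < 1" and k: "k \<ge> 1"
  shows "(\<Sum>n=1..k. residue_part k n X) = 1 / (1 - X)\<^sup>2"
proof -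
  define S where "S = (\<Sum>n=1..k. X ^ (n - 1))"
  define A where "A = (\<Sum>n=1..k. of_nat n * X ^ (n - 1))"
  have S: "(1 - X) * (\<Sum>n=1..m. X ^ (n - 1)) = 1 - X ^ m" for m
  proof (induction m)
    case (Suc m)
    have "(1 - X) * (\<Sum>n=1..Suc m. X ^ (n - 1)) = (1 - X) * (\<Sum>n=1..m. X ^ (n - 1)) + (1 - X) * X ^ m"
      by (simp add: distrib_left)
    also have "\<dots> = 1 - X ^ Suc m" unfolding Suc by (simp add: algebra_simps)
    finally show ?case .
  qed simp
  have A: "(1 - X)\<^sup>2 * (\<Sum>n=1..m. of_nat n * X ^ (n - 1)) = 1 - of_nat (m + 1) * X ^ m + of_nat m * X ^ (m + 1)" for m
  proof (induction m)
    case (Suc m)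
    have "(1 - X)\<^sup>2 * (\<Sum>n=1..Suc m. of_nat n * X ^ (n - 1))
        = (1 - X)\<^sup>2 * (\<Sum>n=1..m. of_nat n * X ^ (n - 1)) + (1 - X)\<^sup>2 * (of_nat (Suc m) * X ^ m)"
      by (simp add: distrib_left)
    also have "\<dots> = 1 - of_nat (Suc m + 1) * X ^ Suc m + of_nat (Suc m) * X ^ (Suc m + 1)"
      unfolding Suc by (simp add: algebra_simps power2_eq_square)
    finally show ?case .
  qed simp
  have "(\<Sum>n=1..k. residue_part k n X) = (\<Sum>n=1..k. of_nat n * X ^ (n - 1) + X ^ k * (of_nat k * X ^ (n - 1) - of_nat n * X ^ (n - 1))) / (1 - X ^ k)\<^sup>2"
    unfolding sum_divide_distrib
    by (intro sum.cong) (auto simp: residue_part_def of_nat_diff algebra_simps)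
  also have "\<dots> = (A + X ^ k * (of_nat k * S - A)) / (1 - X ^ k)\<^sup>2"
    by (simp only: A_def S_def sum.distrib sum_distrib_left[symmetric] sum_subtractf)
  also have "\<dots> = 1 / (1 - X)\<^sup>2"
  proof -
    have "(1 - X)\<^sup>2 * (A + X ^ k * (of_nat k * S - A))
        = ((1 - X)\<^sup>2 * A) * (1 - X ^ k) + X ^ k * of_nat k * (1 - X) * ((1 - X) * S)"
      by (simp add: algebra_simps power2_eq_square)
    also have "\<dots> = (1 - X ^ k)\<^sup>2"
      unfolding A_def S_def A S by (simp add: algebra_simps power2_eq_square)
    finally have "(1 - X)\<^sup>2 * (A + X ^ k * (of_nat k * S - A)) = (1 - X ^ k)\<^sup>2" .
    moreover have "1 - X \<noteq> 0" using X by auto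
    ultimately show ?thesis
      using one_minus_power_neq_0[OF X k] by (simp add: field_simps)
  qed
  finally show ?thesis .
qed

text \<open>Uniform in \<open>X\<close> on every smaller disc; this bounds the lift of the kernel to the bidisc when one argument is fixed.\<close>

lemma norm_residue_part_le:
  assumes X: "cmod X \<le> r" and r: "r < 1" and k: "1 \<le> k" and n: "n \<in> {1..k}"
  shows "cmod (residue_part k n X) \<le> real k / (1 - r)\<^sup>2"
proof -
  have r0: "0 \<le> r" using X norm_ge_zero order_trans by blast
  have pk: "cmod (X ^ j) \<le> 1" for j
    using X r by (simp add: norm_power power_le_one)
  have "cmod (of_nat n + of_nat (k - n) * X ^ k) \<le> real n + real (k - n) * 1"
    by (rule order_trans[OF norm_triangle_ineq]) (auto simp: norm_mult simp del: mult_1_right intro!: mult_left_mono pk)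
  also have "\<dots> = real k" using n by simp
  finally have "cmod (X ^ (n - 1)) * cmod (of_nat n + of_nat (k - n) * X ^ k) \<le> 1 * real k"
    by (intro mult_mono pk) auto
  then have num: "cmod (X ^ (n - 1) * (of_nat n + of_nat (k - n) * X ^ k)) \<le> real k"
    by (simp add: norm_mult)
  have "cmod (X ^ k) \<le> r"
  proof -
    have "cmod (X ^ k) \<le> cmod X ^ 1"
      unfolding norm_power using X r k by (intro power_decreasing) auto
    then show ?thesis using X by simp
  qed
  then have "1 - r \<le> cmod (1 - X ^ k)"
    using norm_triangle_ineq2[of 1 "X ^ k"] by simp
  then have "(1 - r)\<^sup>2 \<le> (cmod (1 - X ^ k))\<^sup>2"
    using r by (intro power_mono) auto
  with num r show ?thesis
    unfolding residue_part_def norm_divide norm_power[of "1 - X ^ k"]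
    by (intro frac_le) auto
qed

lemma residue_part_rotate:
  assumes "\<omega> ^ k = 1"
  shows "residue_part k n (\<omega> * X) = \<omega> ^ (n - 1) * residue_part k n X"
  using assms by (simp add: residue_part_def power_mult_distrib)

lemma measurable_residue_part [measurable]: "residue_part k n \<in> borel_measurable borel"
  unfolding residue_part_def by measurable

lemma lborel_pair_rotate:
  fixes c d :: complex
  assumes "cmod c = 1" "cmod d = 1"
  shows "(lborel \<Otimes>\<^sub>M lborel) = distr (lborel \<Otimes>\<^sub>M lborel) (borel \<Otimes>\<^sub>M borel) (\<lambda>(u, v). (c * u, d * v))"
proof -
  have rot: "(lborel :: complex measure) = distr lborel borel ((*) c)" if "cmod c = 1" for c
    using that distr_lborel_complex_mult[of c] by (simp add: density_1) (metis norm_zero zero_neq_one)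
  have "lborel \<Otimes>\<^sub>M lborel = distr lborel borel ((*) c) \<Otimes>\<^sub>M distr lborel borel ((*) d)"
    using rot[OF assms(1)] rot[OF assms(2)] by simp
  also have "\<dots> = distr (lborel \<Otimes>\<^sub>M lborel) (borel \<Otimes>\<^sub>M borel) (\<lambda>(u, v). (c * u, d * v))"
  proof (rule pair_measure_distr)
    show "sigma_finite_measure (distr lborel borel ((*) d))"
      using rot[OF assms(2)] sigma_finite_lborel by simp
  qed auto
  finally show ?thesis .
qed

text \<open>This is the factor that a mixed product of residue parts acquires under the deck transformation.
Since it differs from \<open>1\<close>, the integral of such a product against an invariant function vanishes.\<close>

lemma root_of_unity_phase_neq_1:
  assumes k: "k \<ge> 1" and "n \<in> {1..k}" "m \<in> {1..k}" "n \<noteq> m"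
  shows "cis (2 * pi / real k) ^ (n - 1) * cnj (cis (2 * pi / real k)) ^ (m - 1) \<noteq> 1"
proof
  let ?\<omega> = "cis (2 * pi / real k)"
  have p: "?\<omega> ^ j = cis (2 * pi * real j / real k)" for j
    by (simp add: Complex.DeMoivre mult_ac)
  assume "?\<omega> ^ (n - 1) * cnj ?\<omega> ^ (m - 1) = 1"
  then have "?\<omega> ^ (n - 1) * (cnj ?\<omega> ^ (m - 1) * ?\<omega> ^ (m - 1)) = ?\<omega> ^ (m - 1)"
    by (simp add: mult.assoc[symmetric])
  also have "cnj ?\<omega> ^ (m - 1) * ?\<omega> ^ (m - 1) = 1"
    by (simp add: power_mult_distrib[symmetric] cis_cnj cis_mult)
  finally have eq: "cis (2 * pi * real (n - 1) / real k) = cis (2 * pi * real (m - 1) / real k)"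
    unfolding p by simp
  have inj: "inj_on (\<lambda>j. cis (2 * pi * real j / real k)) {..<k}"
    using Complex.bij_betw_roots_unity[of k] k by (auto simp: bij_betw_def)
  have "n - 1 = m - 1"
    by (rule inj_onD[OF inj eq]) (use assms in auto)
  with assms show False by auto
qed

text \<open>Write both factors of the bidisc kernel as sums of their residue parts. The transformation
\<open>(u, v) \<mapsto> (\<omega>\<^sup>* u, \<omega> v)\<close>, with \<open>\<omega> = exp (2 \<pi> \<i> / k)\<close>, preserves Lebesgue measure and \<open>g\<close>, and multiplies the product
of the parts \<open>n\<close> and \<open>m\<close> by \<open>\<omega>\<^bsup>n-m\<^esup>\<close>. The integrals with \<open>n \<noteq> m\<close> therefore vanish, and the diagonal
products alone reproduce \<open>g\<close>.\<close>

lemma bidisc_reproducing_symmetric: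
  fixes g :: "complex \<times> complex \<Rightarrow> complex"
  assumes k: "k \<ge> 1"
    and meas [measurable]: "g \<in> borel_measurable (lborel \<Otimes>\<^sub>M lborel)"
    and supp: "\<And>u v. (u, v) \<notin> ball 0 1 \<times> (ball 0 1 - {0}) \<Longrightarrow> g (u, v) = 0"
    and hol1: "\<And>v. v \<in> ball 0 1 - {0} \<Longrightarrow> (\<lambda>u. g (u, v)) holomorphic_on ball 0 1"
    and hol2: "\<And>u. u \<in> ball 0 1 \<Longrightarrow> (\<lambda>v. g (u, v)) holomorphic_on ball 0 1 - {0}"
    and int: "integrable (lborel \<Otimes>\<^sub>M lborel) g"
    and fin: "(\<integral>\<^sup>+p. ennreal ((cmod (g p))\<^sup>2) \<partial>(lborel \<Otimes>\<^sub>M lborel)) < \<infinity>"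
    and sym: "\<And>u v. g (cnj (cis (2 * pi / real k)) * u, cis (2 * pi / real k) * v) = g (u, v)"
    and \<eta>: "\<eta> \<in> ball 0 1" and \<zeta>: "\<zeta> \<in> ball 0 1 - {0}"
  shows "(LINT p|(lborel \<Otimes>\<^sub>M lborel). g p *
      (\<Sum>n=1..k. residue_part k n (\<eta> * cnj (fst p)) * residue_part k n (\<zeta> * cnj (snd p))))
    = of_real (pi\<^sup>2) * g (\<eta>, \<zeta>)"
proof -
  define \<omega> where "\<omega> = cis (2 * pi / real k)"
  define R where "R = (\<lambda>n (p :: complex \<times> complex). residue_part k n (\<eta> * cnj (fst p)) :: complex)"
  define T where "T = (\<lambda>n (p :: complex \<times> complex). residue_part k n (\<zeta> * cnj (snd p)) :: complex)"
  define J where "J = (\<lambda>n m. LINT p|(lborel \<Otimes>\<^sub>M lborel). g p * (R n p * T m p))"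
  have [measurable]: "R n \<in> borel_measurable (lborel \<Otimes>\<^sub>M lborel)" "T n \<in> borel_measurable (lborel \<Otimes>\<^sub>M lborel)" for n
    unfolding R_def T_def by measurable
  have "cmod \<omega> = 1" "\<omega> ^ k = 1"
    using k by (auto simp: \<omega>_def Complex.DeMoivre)
  then have \<omega>: "cmod \<omega> = 1" "\<omega> ^ k = 1" "cnj \<omega> ^ k = 1"
    by (auto simp: complex_cnj_power[symmetric] simp del: complex_cnj_power)
  have ball: "cmod (\<xi> * cnj w) \<le> cmod \<xi>" if "w \<in> ball 0 1" for \<xi> w
    using that mult_left_mono[of "cmod w" 1 "cmod \<xi>"] by (simp add: norm_mult)
  have intJ: "integrable (lborel \<Otimes>\<^sub>M lborel) (\<lambda>p. g p * (R n p * T m p))"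
    if nm: "n \<in> {1..k}" "m \<in> {1..k}" for n m
  proof (rule Bochner_Integration.integrable_bound)
    let ?C = "real k / (1 - cmod \<eta>)\<^sup>2 * (real k / (1 - cmod \<zeta>)\<^sup>2)"
    show "integrable (lborel \<Otimes>\<^sub>M lborel) (\<lambda>p. ?C *\<^sub>R g p)"
      using int by (rule integrable_scaleR_right)
    show "AE p in lborel \<Otimes>\<^sub>M lborel. norm (g p * (R n p * T m p)) \<le> norm (?C *\<^sub>R g p)"
    proof (rule AE_I2)
      fix p :: "complex \<times> complex"
      show "norm (g p * (R n p * T m p)) \<le> norm (?C *\<^sub>R g p)"
      proof (cases "g p = 0")
        case False
        then have p: "fst p \<in> ball 0 1" "snd p \<in> ball 0 1"
          using supp[of "fst p" "snd p"] by (auto simp: mem_Times_iff)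
        have "cmod (R n p) \<le> real k / (1 - cmod \<eta>)\<^sup>2"
          unfolding R_def using ball[OF p(1)] \<eta> k nm by (intro norm_residue_part_le) auto
        moreover have "cmod (T m p) \<le> real k / (1 - cmod \<zeta>)\<^sup>2"
          unfolding T_def using ball[OF p(2)] \<zeta> k nm by (intro norm_residue_part_le) auto
        ultimately have "cmod (R n p) * cmod (T m p) \<le> ?C"
          by (intro mult_mono) auto
        then have "cmod (g p) * (cmod (R n p) * cmod (T m p)) \<le> cmod (g p) * ?C"
          by (intro mult_left_mono) auto
        moreover have "norm (?C *\<^sub>R g p) = cmod (g p) * ?C"
          by (simp add: mult.commute)
        ultimately show ?thesis by (simp only: norm_mult)
      qed simp
    qed
  qed measurable
  have cross: "J n m = 0" if nm: "n \<in> {1..k}" "m \<in> {1..k}" "n \<noteq> m" for n m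
  proof -
    let ?\<psi> = "\<lambda>(u, v). (cnj \<omega> * u, \<omega> * v)"
    have "J n m = (LINT p|distr (lborel \<Otimes>\<^sub>M lborel) (borel \<Otimes>\<^sub>M borel) ?\<psi>. g p * (R n p * T m p))"
      unfolding J_def using \<omega> lborel_pair_rotate[of "cnj \<omega>" \<omega>] by simp
    also have "\<dots> = (LINT p|(lborel \<Otimes>\<^sub>M lborel). g (?\<psi> p) * (R n (?\<psi> p) * T m (?\<psi> p)))"
    proof (rule integral_distr)
      have "sets (borel \<Otimes>\<^sub>M borel :: (complex \<times> complex) measure) = sets (lborel \<Otimes>\<^sub>M lborel)"
        by (intro sets_pair_measure_cong) auto
      then show "(\<lambda>p. g p * (R n p * T m p)) \<in> borel_measurable (borel \<Otimes>\<^sub>M borel)"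
        by (simp cong: measurable_cong_sets)
    qed measurable
    also have "\<dots> = (LINT p|(lborel \<Otimes>\<^sub>M lborel). (\<omega> ^ (n - 1) * cnj \<omega> ^ (m - 1)) * (g p * (R n p * T m p)))"
    proof (rule Bochner_Integration.integral_cong[OF refl])
      fix p :: "complex \<times> complex"
      obtain u v where p: "p = (u, v)" by force
      have "R n (?\<psi> p) = \<omega> ^ (n - 1) * R n p"
        unfolding R_def residue_part_rotate[OF \<omega>(2), symmetric] p by (simp add: mult_ac)
      moreover have "T m (?\<psi> p) = cnj \<omega> ^ (m - 1) * T m p"
        unfolding T_def residue_part_rotate[OF \<omega>(3), symmetric] p by (simp add: mult_ac)
      moreover have "g (?\<psi> p) = g p"
        using sym[of u v] by (simp add: p \<omega>_def)
      ultimately show "g (?\<psi> p) * (R n (?\<psi> p) * T m (?\<psi> p)) = (\<omega> ^ (n - 1) * cnj \<omega> ^ (m - 1)) * (g p * (R n p * T m p))"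
        by (simp add: mult_ac)
    qed
    also have "\<dots> = (\<omega> ^ (n - 1) * cnj \<omega> ^ (m - 1)) * J n m"
      unfolding J_def by (rule integral_mult_right_zero)
    finally show ?thesis
      using root_of_unity_phase_neq_1[OF k nm] unfolding \<omega>_def[symmetric] by simp
  qed
  let ?K = "\<lambda>p. g p / ((1 - \<eta> * cnj (fst p))\<^sup>2 * (1 - \<zeta> * cnj (snd p))\<^sup>2)"
  have K: "?K p = (\<Sum>n=1..k. \<Sum>m=1..k. g p * (R n p * T m p))" for p
  proof (cases "g p = 0")
    case False
    then have p: "fst p \<in> ball 0 1" "snd p \<in> ball 0 1"
      using supp[of "fst p" "snd p"] by (auto simp: mem_Times_iff)
    have "(\<Sum>n=1..k. R n p) = 1 / (1 - \<eta> * cnj (fst p))\<^sup>2"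
      unfolding R_def using ball[OF p(1), of \<eta>] \<eta> k by (intro sum_residue_part) auto
    moreover have "(\<Sum>m=1..k. T m p) = 1 / (1 - \<zeta> * cnj (snd p))\<^sup>2"
      unfolding T_def using ball[OF p(2), of \<zeta>] \<zeta> k by (intro sum_residue_part) auto
    ultimately have "?K p = g p * ((\<Sum>n=1..k. R n p) * (\<Sum>m=1..k. T m p))" by simp
    also have "\<dots> = (\<Sum>n=1..k. \<Sum>m=1..k. g p * (R n p * T m p))"
      by (subst sum_product) (simp only: sum_distrib_left)
    finally show ?thesis .
  qed simp
  have intK: "integrable (lborel \<Otimes>\<^sub>M lborel) ?K"
    unfolding K using intJ by (intro Bochner_Integration.integrable_sum) auto
  have "of_real (pi\<^sup>2) * g (\<eta>, \<zeta>) = (LINT p|(lborel \<Otimes>\<^sub>M lborel). ?K p)"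
    using bidisc_reproducing[OF meas supp hol1 hol2 int fin \<eta> \<zeta> intK] by simp
  also have "\<dots> = (\<Sum>n=1..k. \<Sum>m=1..k. J n m)"
    unfolding K J_def
    by (subst Bochner_Integration.integral_sum, intro Bochner_Integration.integrable_sum intJ, simp, simp,
        intro sum.cong refl Bochner_Integration.integral_sum intJ) auto
  also have "\<dots> = (\<Sum>n=1..k. J n n)"
  proof (rule sum.cong[OF refl])
    fix n assume n: "n \<in> {1..k}"
    have "(\<Sum>m=1..k. J n m) = (\<Sum>m\<in>{n}. J n m)"
      using n cross by (intro sum.mono_neutral_right) auto
    then show "(\<Sum>m=1..k. J n m) = J n n" by simp
  qed
  also have "\<dots> = (LINT p|(lborel \<Otimes>\<^sub>M lborel). g p * (\<Sum>n=1..k. R n p * T n p))"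
    unfolding J_def sum_distrib_left
    by (intro Bochner_Integration.integral_sum[symmetric] intJ) auto
  finally show ?thesis unfolding R_def T_def by simp
qed

section \<open>Bergman spaces in several variables\<close>

text \<open>The pointwise condition of \<^const>\<open>holomorphic_on_Cn\<close>, named in order to state its closure properties.\<close>

definition complex_differentiable :: "(complex ^ 'n::finite \<Rightarrow> complex) \<Rightarrow> complex ^ 'n \<Rightarrow> bool"
  where "complex_differentiable f z \<longleftrightarrow> (\<exists>D. (f has_derivative D) (at z) \<and> (\<forall>c v. D (c *s v) = c * D v))"

lemma holomorphic_on_Cn_iff: "holomorphic_on_Cn f \<Omega> \<longleftrightarrow> (\<forall>z\<in>\<Omega>. complex_differentiable f z)"
  by (simp add: holomorphic_on_Cn_def complex_differentiable_def)

lemma holomorphic_on_Cn_imp_continuous_on: "holomorphic_on_Cn f \<Omega> \<Longrightarrow> continuous_on \<Omega> f"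
  unfolding holomorphic_on_Cn_def
  by (intro continuous_at_imp_continuous_on ballI) (meson has_derivative_continuous)

lemma complex_differentiable_transform:
  assumes "complex_differentiable f z" "open S" "z \<in> S" "\<And>w. w \<in> S \<Longrightarrow> f w = g w"
  shows "complex_differentiable g z"
  using assms unfolding complex_differentiable_def
  by (metis has_derivative_transform_within_open)

named_theorems complex_differentiable_intros

lemma complex_differentiable_const [complex_differentiable_intros]: "complex_differentiable (\<lambda>_. c) z"
  unfolding complex_differentiable_def by (intro exI[of _ "\<lambda>_. 0"]) auto

lemma complex_differentiable_vec_nth [complex_differentiable_intros]: "complex_differentiable (\<lambda>w. w $ i) z"
  unfolding complex_differentiable_def
  by (intro exI[of _ "\<lambda>v. v $ i"] conjI bounded_linear_imp_has_derivative bounded_linear_vec_nth) auto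

lemma complex_differentiable_add [complex_differentiable_intros]:
  assumes "complex_differentiable f z" "complex_differentiable g z"
  shows "complex_differentiable (\<lambda>w. f w + g w) z"
proof -
  obtain D E where "(f has_derivative D) (at z)" "\<And>c v. D (c *s v) = c * D v"
      "(g has_derivative E) (at z)" "\<And>c v. E (c *s v) = c * E v"
    using assms unfolding complex_differentiable_def by blast
  then show ?thesis
    unfolding complex_differentiable_def
    by (intro exI[of _ "\<lambda>v. D v + E v"]) (auto intro: has_derivative_add simp: algebra_simps)
qed

lemma complex_differentiable_mult [complex_differentiable_intros]:
  assumes "complex_differentiable f z" "complex_differentiable g z"
  shows "complex_differentiable (\<lambda>w. f w * g w) z"
proof -
  obtain D E where "(f has_derivative D) (at z)" "\<And>c v. D (c *s v) = c * D v"
      "(g has_derivative E) (at z)" "\<And>c v. E (c *s v) = c * E v"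
    using assms unfolding complex_differentiable_def by blast
  moreover from this have "((\<lambda>w. f w * g w) has_derivative (\<lambda>v. f z * E v + D v * g z)) (at z)"
    by (intro has_derivative_mult)
  ultimately show ?thesis
    unfolding complex_differentiable_def
    by (intro exI[of _ "\<lambda>v. f z * E v + D v * g z"] conjI) (auto simp: algebra_simps)
qed

lemma complex_differentiable_diff [complex_differentiable_intros]:
  assumes "complex_differentiable f z" "complex_differentiable g z"
  shows "complex_differentiable (\<lambda>w. f w - g w) z"
  using complex_differentiable_add[OF assms(1)
      complex_differentiable_mult[OF complex_differentiable_const[of "-1"] assms(2)]] by simp

lemma complex_differentiable_divide [complex_differentiable_intros]:
  assumes "complex_differentiable f z" "complex_differentiable g z" "g z \<noteq> 0"
  shows "complex_differentiable (\<lambda>w. f w / g w) z"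
proof -
  obtain E where "(g has_derivative E) (at z)" "\<And>c v. E (c *s v) = c * E v"
    using assms unfolding complex_differentiable_def by blast
  moreover from this have "((\<lambda>w. inverse (g w)) has_derivative (\<lambda>v. - (inverse (g z) * E v * inverse (g z)))) (at z)"
    using assms(3) by (intro Deriv.has_derivative_inverse)
  ultimately have "complex_differentiable (\<lambda>w. inverse (g w)) z"
    unfolding complex_differentiable_def
    by (intro exI[of _ "\<lambda>v. - (inverse (g z) * E v * inverse (g z))"] conjI) (auto simp: algebra_simps)
  from complex_differentiable_mult[OF assms(1) this] show ?thesis
    by (simp add: divide_inverse)
qed

lemma complex_differentiable_power [complex_differentiable_intros]:
  assumes "complex_differentiable f z"
  shows "complex_differentiable (\<lambda>w. f w ^ n) z"
  by (induction n) (auto intro!: complex_differentiable_intros assms)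

lemma complex_differentiable_sum [complex_differentiable_intros]:
  assumes "\<And>i. i \<in> A \<Longrightarrow> complex_differentiable (f i) z"
  shows "complex_differentiable (\<lambda>w. \<Sum>i\<in>A. f i w) z"
  using assms by (induction A rule: infinite_finite_induct) (auto intro!: complex_differentiable_intros)

lemma bounded_linear_pair_vec: "bounded_linear pair_vec"
  by (intro linear_conv_bounded_linear[THEN iffD1] linearI)
     (auto simp: vec_eq_iff forall_2)

text \<open>Restricting a holomorphic function of two variables to a holomorphic curve. The complex linearity of the
derivative is what turns it into multiplication by a complex number.\<close>

lemma field_differentiable_pair_vec:
  assumes f: "complex_differentiable f (pair_vec (a x, b x))"
    and a: "a field_differentiable (at x)" and b: "b field_differentiable (at x)"
  shows "(\<lambda>x. f (pair_vec (a x, b x))) field_differentiable (at x)"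
proof -
  obtain D where D: "(f has_derivative D) (at (pair_vec (a x, b x)))" "\<And>c v. D (c *s v) = c * D v"
    using f unfolding complex_differentiable_def by blast
  obtain a' b' where "(a has_derivative (*) a') (at x)" "(b has_derivative (*) b') (at x)"
    using a b unfolding field_differentiable_def has_field_derivative_def by blast
  then have "((\<lambda>x. pair_vec (a x, b x)) has_derivative (\<lambda>h. pair_vec (a' * h, b' * h))) (at x)"
    by (intro bounded_linear.has_derivative[OF bounded_linear_pair_vec] has_derivative_Pair)
  from has_derivative_compose[OF this D(1)]
  have "((\<lambda>x. f (pair_vec (a x, b x))) has_derivative (\<lambda>h. D (pair_vec (a' * h, b' * h)))) (at x)" .
  moreover have "pair_vec (a' * h, b' * h) = h *s pair_vec (a', b')" for h
    by (simp add: vec_eq_iff forall_2 mult.commute)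
  ultimately have "((\<lambda>x. f (pair_vec (a x, b x))) has_derivative (*) (D (pair_vec (a', b')))) (at x)"
    by (simp add: D(2) mult.commute[of _ "D _"])
  then show ?thesis
    unfolding field_differentiable_def has_field_derivative_def by blast
qed

lemma bergman_space_measurable:
  assumes "open \<Omega>" "f \<in> bergman_space \<Omega>"
  shows "(\<lambda>w. indicator \<Omega> w *\<^sub>R f w) \<in> borel_measurable borel"
  using assms
  by (intro borel_measurable_continuous_on_indicator holomorphic_on_Cn_imp_continuous_on)
     (auto simp: bergman_space_def)

lemma bergman_space_set_integrable_mult:
  assumes "open \<Omega>" "f \<in> bergman_space \<Omega>" "g \<in> bergman_space \<Omega>"
  shows "set_integrable lborel \<Omega> (\<lambda>w. cnj (f w) * g w)"
  unfolding set_integrable_def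
proof (rule Bochner_Integration.integrable_bound)
  have [measurable]: "(\<lambda>w. indicator \<Omega> w *\<^sub>R f w) \<in> borel_measurable borel"
      "(\<lambda>w. indicator \<Omega> w *\<^sub>R g w) \<in> borel_measurable borel"
    using assms by (auto intro: bergman_space_measurable)
  have eq: "(\<lambda>w. indicator \<Omega> w *\<^sub>R (cnj (f w) * g w))
      = (\<lambda>w. cnj (indicator \<Omega> w *\<^sub>R f w) * (indicator \<Omega> w *\<^sub>R g w))"
    by (auto simp: fun_eq_iff indicator_def)
  show "(\<lambda>w. indicator \<Omega> w *\<^sub>R (cnj (f w) * g w)) \<in> borel_measurable lborel"
    unfolding eq measurable_lborel2 by measurable
  show "integrable lborel (\<lambda>w. indicator \<Omega> w *\<^sub>R (cmod (f w))\<^sup>2 + indicator \<Omega> w *\<^sub>R (cmod (g w))\<^sup>2)"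
    using assms by (intro Bochner_Integration.integrable_add) (auto simp: bergman_space_def set_integrable_def)
  have le: "x * y \<le> x\<^sup>2 + y\<^sup>2" for x y :: real
    using zero_le_power2[of "x - y"] zero_le_power2[of "x + y"] by (simp add: power2_eq_square algebra_simps)
  show "AE w in lborel. norm (indicator \<Omega> w *\<^sub>R (cnj (f w) * g w))
      \<le> norm (indicator \<Omega> w *\<^sub>R (cmod (f w))\<^sup>2 + indicator \<Omega> w *\<^sub>R (cmod (g w))\<^sup>2)"
    using le by (auto simp: norm_mult indicator_def)
qed

lemma bergman_space_diff:
  assumes "open \<Omega>" "f \<in> bergman_space \<Omega>" "g \<in> bergman_space \<Omega>"
  shows "(\<lambda>w. f w - g w) \<in> bergman_space \<Omega>"
proof -
  have [measurable]: "(\<lambda>w. indicator \<Omega> w *\<^sub>R f w) \<in> borel_measurable borel"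
      "(\<lambda>w. indicator \<Omega> w *\<^sub>R g w) \<in> borel_measurable borel"
    using assms by (auto intro: bergman_space_measurable)
  have "set_integrable lborel \<Omega> (\<lambda>w. (cmod (f w - g w))\<^sup>2)"
    unfolding set_integrable_def
  proof (rule Bochner_Integration.integrable_bound)
    have eq: "(\<lambda>w. indicator \<Omega> w *\<^sub>R (cmod (f w - g w))\<^sup>2)
        = (\<lambda>w. (cmod (indicator \<Omega> w *\<^sub>R f w - indicator \<Omega> w *\<^sub>R g w))\<^sup>2)"
      by (auto simp: fun_eq_iff indicator_def)
    show "(\<lambda>w. indicator \<Omega> w *\<^sub>R (cmod (f w - g w))\<^sup>2) \<in> borel_measurable lborel"
      unfolding eq measurable_lborel2 by measurable
    show "integrable lborel (\<lambda>w. 2 *\<^sub>R (indicator \<Omega> w *\<^sub>R (cmod (f w))\<^sup>2 + indicator \<Omega> w *\<^sub>R (cmod (g w))\<^sup>2))"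
      using assms
      by (intro integrable_scaleR_right Bochner_Integration.integrable_add) (auto simp: bergman_space_def set_integrable_def)
    have le: "(cmod (a - b))\<^sup>2 \<le> 2 * ((cmod a)\<^sup>2 + (cmod b)\<^sup>2)" for a b
    proof -
      have "(cmod (a - b))\<^sup>2 \<le> (cmod a + cmod b)\<^sup>2"
        by (intro power_mono norm_triangle_ineq4) auto
      also have "\<dots> \<le> 2 * ((cmod a)\<^sup>2 + (cmod b)\<^sup>2)"
        using zero_le_power2[of "cmod a - cmod b"] by (simp add: power2_eq_square algebra_simps)
      finally show ?thesis .
    qed
    show "AE w in lborel. norm (indicator \<Omega> w *\<^sub>R (cmod (f w - g w))\<^sup>2)
      \<le> norm (2 *\<^sub>R (indicator \<Omega> w *\<^sub>R (cmod (f w))\<^sup>2 + indicator \<Omega> w *\<^sub>R (cmod (g w))\<^sup>2))"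
      using le by (auto simp: indicator_def)
  qed
  then show ?thesis
    using assms by (auto simp: bergman_space_def holomorphic_on_Cn_iff intro!: complex_differentiable_intros)
qed

text \<open>If both kernels reproduce, the conjugate \<open>h\<close> of their difference in the second variable lies in the Bergman space, and
evaluating \<open>h z\<close> with either kernel shows that the integral of \<open>\<bar>h\<bar>\<^sup>2\<close> vanishes. So \<open>h\<close> is zero almost everywhere,
hence everywhere on \<open>\<Omega>\<close> by continuity.\<close>

lemma bergman_kernel_unique:
  assumes op: "open \<Omega>" and B1: "is_bergman_kernel \<Omega> B1" and B2: "is_bergman_kernel \<Omega> B2"
    and z: "z \<in> \<Omega>" and w: "w \<in> \<Omega>"
  shows "B1 z w = B2 z w"
proof -
  define h where "h = (\<lambda>w. cnj (B1 z w) - cnj (B2 z w))"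
  have A: "(\<lambda>w. cnj (B1 z w)) \<in> bergman_space \<Omega>" "(\<lambda>w. cnj (B2 z w)) \<in> bergman_space \<Omega>"
    using B1 B2 z by (auto simp: is_bergman_kernel_def)
  then have h: "h \<in> bergman_space \<Omega>"
    unfolding h_def by (intro bergman_space_diff op)
  have "h z = (LINT w:\<Omega>|lborel. B1 z w * h w)" "h z = (LINT w:\<Omega>|lborel. B2 z w * h w)"
    using B1 B2 z h by (auto simp: is_bergman_kernel_def)
  moreover have "set_integrable lborel \<Omega> (\<lambda>w. B1 z w * h w)" "set_integrable lborel \<Omega> (\<lambda>w. B2 z w * h w)"
    using bergman_space_set_integrable_mult[OF op A(1) h] bergman_space_set_integrable_mult[OF op A(2) h] by auto
  ultimately have "(LINT w:\<Omega>|lborel. B1 z w * h w - B2 z w * h w) = 0"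
    by (simp add: set_integral_diff)
  moreover have "B1 z w * h w - B2 z w * h w = of_real ((cmod (h w))\<^sup>2)" for w
    unfolding complex_norm_square h_def by (simp add: algebra_simps)
  ultimately have "(LINT w:\<Omega>|lborel. complex_of_real ((cmod (h w))\<^sup>2)) = 0" by simp
  then have "(LINT w:\<Omega>|lborel. (cmod (h w))\<^sup>2) = 0"
    by (simp only: set_integral_complex_of_real of_real_eq_0_iff)
  then have "AE w in lborel. indicator \<Omega> w *\<^sub>R (cmod (h w))\<^sup>2 = 0"
    using h unfolding set_lebesgue_integral_def
    by (subst (asm) integral_nonneg_eq_0_iff_AE) (auto simp: bergman_space_def set_integrable_def)
  then have AE: "AE w in lborel. w \<notin> {w\<in>\<Omega>. h w \<noteq> 0}"
    by eventually_elim (auto simp: indicator_def split: if_splits)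
  have "open (\<Omega> \<inter> h -` (- {0}))"
    using h op by (intro continuous_open_preimage holomorphic_on_Cn_imp_continuous_on) (auto simp: bergman_space_def)
  moreover have eq: "\<Omega> \<inter> h -` (- {0}) = {w\<in>\<Omega>. h w \<noteq> 0}" by auto
  ultimately have op': "open {w\<in>\<Omega>. h w \<noteq> 0}" by simp
  have "{w\<in>\<Omega>. h w \<noteq> 0} \<in> null_sets lborel"
    using AE op' by (subst AE_iff_null_sets) (auto intro: borel_open)
  then have "negligible {w\<in>\<Omega>. h w \<noteq> 0}"
    by (simp add: negligible_iff_null_sets null_sets_completionI)
  then have "{w\<in>\<Omega>. h w \<noteq> 0} = {}"
    using op' open_not_negligible by blast
  then have "h w = 0" using w by blast
  then show ?thesis by (simp add: h_def)
qed

section \<open>The Bergman kernel of the Hartogs triangle\<close>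

lemma open_hartogs_triangle: "open (hartogs_triangle k)"
  unfolding hartogs_triangle_def
  by (intro open_Collect_conj open_Collect_less continuous_intros)

lemma sets_hartogs_triangle [measurable]: "hartogs_triangle k \<in> sets borel"
  by (intro borel_open open_hartogs_triangle)

lemma hartogs_cover_mem_iff:
  assumes k: "k \<ge> 1"
  shows "hartogs_cover k (u, v) \<in> hartogs_triangle k \<longleftrightarrow> u \<in> ball 0 1 \<and> v \<in> ball 0 1 - {0}"
proof (cases "v = 0")
  case True
  then show ?thesis using k by (simp add: hartogs_triangle_def power_0_left)
next
  case False
  then have "cmod (u * v) ^ k < cmod (v ^ k) \<longleftrightarrow> cmod u ^ k < 1"
    by (simp add: norm_mult norm_power power_mult_distrib)
  moreover have "x ^ k < 1 \<longleftrightarrow> x < 1" if "0 \<le> x" for x :: real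
    using that k power_less_one_iff[of x k] by auto
  ultimately show ?thesis
    using False by (simp add: hartogs_triangle_def norm_power)
qed

lemma hartogs_cover_surj:
  assumes k: "k \<ge> 1" and z: "z \<in> hartogs_triangle k"
  obtains \<eta> \<zeta> where "\<eta> \<in> ball 0 1" "\<zeta> \<in> ball 0 1 - {0}" "hartogs_cover k (\<eta>, \<zeta>) = z"
proof -
  have "0 \<le> cmod (z $ 1) ^ k" by simp
  then have "cmod (z $ 2) > 0" using z unfolding hartogs_triangle_def by (simp only: mem_Collect_eq) linarith
  then have "z $ 2 \<noteq> 0" by auto
  then obtain \<zeta> where \<zeta>: "\<zeta> \<noteq> 0" "z $ 2 = \<zeta> ^ k"
    using exists_complex_root_nonzero[of "z $ 2" k] k by auto
  then have eq: "hartogs_cover k (z $ 1 / \<zeta>, \<zeta>) = z"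
    by (simp add: vec_eq_iff forall_2)
  with z have "z $ 1 / \<zeta> \<in> ball 0 1" "\<zeta> \<in> ball 0 1 - {0}"
    using hartogs_cover_mem_iff[OF k, of "z $ 1 / \<zeta>" \<zeta>] by auto
  with eq show thesis using that by blast
qed

text \<open>The diagonal products of residue parts from \<open>bidisc_reproducing_symmetric\<close>, rewritten in the coordinates of the
Hartogs triangle: if \<open>z\<close> and \<open>w\<close> are the images of \<open>(\<eta>, \<zeta>)\<close> and \<open>(u, v)\<close> under the covering, then with \<open>X = \<eta> u\<^sup>*\<close> and \<open>Y = \<zeta> v\<^sup>*\<close> one has \<open>s = X Y\<close> and \<open>t = Y\<^sup>k\<close>, so that \<open>X\<^sup>k = s\<^sup>k / t\<close>.\<close>

definition hartogs_kernel :: "nat \<Rightarrow> complex ^ 2 \<Rightarrow> complex ^ 2 \<Rightarrow> complex"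
  where "hartogs_kernel k z w =
    (let s = z $ 1 * cnj (w $ 1); t = z $ 2 * cnj (w $ 2) in
      (\<Sum>n=1..k. s ^ (n - 1) * (of_nat n * t + of_nat (k - n) * s ^ k) * (of_nat n + of_nat (k - n) * t))
      / (of_real (real k * pi\<^sup>2) * (1 - t)\<^sup>2 * (t - s ^ k)\<^sup>2))"

lemma hartogs_kernel_cover:
  assumes "\<zeta> \<noteq> 0" "v \<noteq> 0"
  shows "hartogs_kernel k (hartogs_cover k (\<eta>, \<zeta>)) (hartogs_cover k (u, v))
    = (\<Sum>n=1..k. residue_part k n (\<eta> * cnj u) * residue_part k n (\<zeta> * cnj v))
      / (of_real (real k * pi\<^sup>2) * (\<zeta> * cnj v) ^ k)"
proof -
  define X where "X = \<eta> * cnj u"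
  define Y where "Y = \<zeta> * cnj v"
  have Y: "Y \<noteq> 0" using assms by (simp add: Y_def)
  have s: "hartogs_cover k (\<eta>, \<zeta>) $ 1 * cnj (hartogs_cover k (u, v) $ 1) = X * Y"
    by (simp add: X_def Y_def mult_ac)
  have t: "hartogs_cover k (\<eta>, \<zeta>) $ 2 * cnj (hartogs_cover k (u, v) $ 2) = Y ^ k"
    by (simp add: Y_def power_mult_distrib)
  have summand: "(X * Y) ^ (n - 1) * (of_nat n * Y ^ k + of_nat (k - n) * (X * Y) ^ k) * (of_nat n + of_nat (k - n) * Y ^ k)
        / (C * (1 - Y ^ k)\<^sup>2 * (Y ^ k - (X * Y) ^ k)\<^sup>2)
      = residue_part k n X * residue_part k n Y / (C * Y ^ k)" for n C
  proof -
    have "Y ^ k - (X * Y) ^ k = Y ^ k * (1 - X ^ k)" by (simp add: power_mult_distrib algebra_simps)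
    moreover have "of_nat n * Y ^ k + of_nat (k - n) * (X * Y) ^ k = Y ^ k * (of_nat n + of_nat (k - n) * X ^ k)"
      by (simp add: power_mult_distrib algebra_simps)
    moreover have "Y ^ k \<noteq> 0" using Y by simp
    ultimately show ?thesis
      unfolding residue_part_def by (simp add: power_mult_distrib power2_eq_square mult_ac)
  qed
  show ?thesis
    unfolding hartogs_kernel_def Let_def s t sum_divide_distrib summand X_def[symmetric] Y_def[symmetric] ..
qed

lemma measurable_vec_nth [measurable]: "(\<lambda>w::complex^2. w $ i) \<in> borel_measurable borel"
  by (intro borel_measurable_continuous_onI continuous_intros)

lemma measurable_hartogs_kernel [measurable]: "hartogs_kernel k z \<in> borel_measurable borel"
  unfolding hartogs_kernel_def Let_def by measurable

text \<open>The factor \<open>v\<^sup>k\<close> is the Jacobian determinant of the covering up to the constant \<open>k\<close>. It makes the lift an isometry up to a constant.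
The value \<open>0\<close> off the preimage of the triangle lets all integrals range over the whole space.\<close>

definition hartogs_lift :: "nat \<Rightarrow> (complex ^ 2 \<Rightarrow> complex) \<Rightarrow> complex \<times> complex \<Rightarrow> complex"
  where "hartogs_lift k f p = snd p ^ k * (indicator (hartogs_triangle k) (hartogs_cover k p) *\<^sub>R f (hartogs_cover k p))"

lemma nn_integral_hartogs_lift:
  assumes k: "k \<ge> 1" and [measurable]: "(\<lambda>w. indicator (hartogs_triangle k) w *\<^sub>R f w) \<in> borel_measurable borel"
  shows "(\<integral>\<^sup>+w. ennreal (indicator (hartogs_triangle k) w *\<^sub>R (cmod (f w))\<^sup>2) \<partial>lborel)
    = ennreal (real k) * (\<integral>\<^sup>+p. ennreal ((cmod (hartogs_lift k f p))\<^sup>2) \<partial>(lborel \<Otimes>\<^sub>M lborel))"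
proof -
  let ?F = "\<lambda>w. indicator (hartogs_triangle k) w *\<^sub>R f w"
  have "(\<integral>\<^sup>+w. ennreal (indicator (hartogs_triangle k) w *\<^sub>R (cmod (f w))\<^sup>2) \<partial>lborel)
      = (\<integral>\<^sup>+w. ennreal ((cmod (?F w))\<^sup>2) * indicator {w. cmod (w $ 2) \<le> 1} w \<partial>lborel)"
    by (intro nn_integral_cong) (auto simp: indicator_def hartogs_triangle_def)
  also have "\<dots> = (\<integral>\<^sup>+p. ennreal ((cmod (?F (hartogs_cover k p)))\<^sup>2)
      * ennreal (real k * cmod (snd p) ^ (2 * k) * indicator (cball 0 1) (snd p)) \<partial>(lborel \<Otimes>\<^sub>M lborel))"
    by (rule nn_integral_hartogs_cover[OF _ k]) measurable
  also have "\<dots> = (\<integral>\<^sup>+p. ennreal (real k) * ennreal ((cmod (hartogs_lift k f p))\<^sup>2) \<partial>(lborel \<Otimes>\<^sub>M lborel))"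
  proof (rule nn_integral_cong)
    fix p :: "complex \<times> complex"
    obtain u v where p: "p = (u, v)" by force
    show "ennreal ((cmod (?F (hartogs_cover k p)))\<^sup>2)
        * ennreal (real k * cmod (snd p) ^ (2 * k) * indicator (cball 0 1) (snd p))
        = ennreal (real k) * ennreal ((cmod (hartogs_lift k f p))\<^sup>2)"
    proof (cases "hartogs_cover k p \<in> hartogs_triangle k")
      case True
      then have "cmod v \<le> 1" using hartogs_cover_mem_iff[OF k, of u v] p by auto
      then show ?thesis
        using True by (simp add: p hartogs_lift_def ennreal_mult[symmetric] norm_mult norm_power power_mult_distrib power_mult[symmetric] mult_ac)
    qed (simp add: hartogs_lift_def)
  qed
  also have "\<dots> = ennreal (real k) * (\<integral>\<^sup>+p. ennreal ((cmod (hartogs_lift k f p))\<^sup>2) \<partial>(lborel \<Otimes>\<^sub>M lborel))"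
    unfolding hartogs_lift_def by (rule nn_integral_cmult) measurable
  finally show ?thesis .
qed

text \<open>The lift of \<open>f\<close> is invariant under the deck transformations of the covering and square integrable, so the symmetric
reproducing formula on the bidisc applies to it. In the integrand over the triangle, pulled back along the covering, the weight
\<open>k \<bar>v\<bar>\<^bsup>2k\<^esup>\<close> supplies the factor \<open>v\<^sup>k\<close> of the lift and cancels the factor \<open>v\<^sup>*\<^sup>k\<close> in the denominator of the kernel.\<close>

lemma hartogs_kernel_reproducing:
  assumes k: "k \<ge> 1" and z: "z \<in> hartogs_triangle k" and f: "f \<in> bergman_space (hartogs_triangle k)"
  shows "f z = (LINT w:hartogs_triangle k|lborel. hartogs_kernel k z w * f w)"
proof -
  obtain \<eta> \<zeta> where \<eta>: "\<eta> \<in> ball 0 1" and \<zeta>: "\<zeta> \<in> ball 0 1 - {0}" and z_eq: "hartogs_cover k (\<eta>, \<zeta>) = z"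
    using hartogs_cover_surj[OF k z] .
  let ?\<Omega> = "hartogs_triangle k" and ?\<Phi> = "hartogs_cover k"
  let ?F = "\<lambda>w. indicator ?\<Omega> w *\<^sub>R f w"
  have F[measurable]: "?F \<in> borel_measurable borel"
    by (rule bergman_space_measurable[OF open_hartogs_triangle f])
  define g where "g = hartogs_lift k f"
  have g[measurable]: "g \<in> borel_measurable (lborel \<Otimes>\<^sub>M lborel)"
    unfolding g_def hartogs_lift_def by measurable
  have supp: "g (u, v) = 0" if "(u, v) \<notin> ball 0 1 \<times> (ball 0 1 - {0})" for u v
    using that hartogs_cover_mem_iff[OF k, of u v] by (auto simp: g_def hartogs_lift_def)
  have gval: "g (u, v) = v ^ k * f (?\<Phi> (u, v))" if "u \<in> ball 0 1" "v \<in> ball 0 1 - {0}" for u v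
    using that hartogs_cover_mem_iff[OF k, of u v] by (auto simp: g_def hartogs_lift_def)
  have cd: "complex_differentiable f w" if "w \<in> ?\<Omega>" for w
    using f that by (auto simp: bergman_space_def holomorphic_on_Cn_iff)
  have hol1: "(\<lambda>u. g (u, v)) holomorphic_on ball 0 1" if v: "v \<in> ball 0 1 - {0}" for v
  proof -
    have "(\<lambda>u. f (?\<Phi> (u, v))) holomorphic_on ball 0 1"
      unfolding hartogs_cover_def fst_conv snd_conv
    proof (rule holomorphic_onI, rule field_differentiable_at_within, rule field_differentiable_pair_vec)
      fix u :: complex assume "u \<in> ball 0 1"
      then show "complex_differentiable f (pair_vec (u * v, v ^ k))"
        using v hartogs_cover_mem_iff[OF k, of u v] by (intro cd) (auto simp: hartogs_cover_def)
    qed (auto intro!: derivative_intros)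
    then have "(\<lambda>u. v ^ k * f (?\<Phi> (u, v))) holomorphic_on ball 0 1"
      by (intro holomorphic_intros)
    then show ?thesis
      by (rule holomorphic_transform) (use v in \<open>simp add: gval\<close>)
  qed
  have hol2: "(\<lambda>v. g (u, v)) holomorphic_on ball 0 1 - {0}" if u: "u \<in> ball 0 1" for u
  proof -
    have "(\<lambda>v. f (?\<Phi> (u, v))) holomorphic_on ball 0 1 - {0}"
      unfolding hartogs_cover_def fst_conv snd_conv
    proof (rule holomorphic_onI, rule field_differentiable_at_within, rule field_differentiable_pair_vec)
      fix v :: complex assume "v \<in> ball 0 1 - {0}"
      then show "complex_differentiable f (pair_vec (u * v, v ^ k))"
        using u hartogs_cover_mem_iff[OF k, of u v] by (intro cd) (auto simp: hartogs_cover_def)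
    qed (auto intro!: derivative_intros)
    then have "(\<lambda>v. v ^ k * f (?\<Phi> (u, v))) holomorphic_on ball 0 1 - {0}"
      by (intro holomorphic_intros)
    then show ?thesis
      by (rule holomorphic_transform) (use u in \<open>simp add: gval\<close>)
  qed
  \<comment> \<open>Both coordinates \<open>u v\<close> and \<open>v\<^sup>k\<close> of the covering and the factor \<open>v\<^sup>k\<close> are invariant.\<close>
  have sym: "g (cnj (cis (2 * pi / real k)) * u, cis (2 * pi / real k) * v) = g (u, v)" for u v
  proof -
    define \<omega> where "\<omega> = cis (2 * pi / real k)"
    have "\<omega> ^ k = 1" using k by (simp add: \<omega>_def Complex.DeMoivre)
    then have pow: "(\<omega> * v) ^ k = v ^ k" by (simp add: power_mult_distrib)
    have "cnj \<omega> * \<omega> = 1" by (simp add: \<omega>_def cis_cnj cis_mult)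
    moreover have "cnj \<omega> * u * (\<omega> * v) = (cnj \<omega> * \<omega>) * (u * v)" by (simp add: mult_ac)
    ultimately have prod: "cnj \<omega> * u * (\<omega> * v) = u * v" by simp
    show ?thesis
      unfolding \<omega>_def[symmetric] g_def hartogs_lift_def hartogs_cover_def fst_conv snd_conv pow prod ..
  qed
  have "set_integrable lborel ?\<Omega> (\<lambda>w. (cmod (f w))\<^sup>2)"
    using f by (simp add: bergman_space_def)
  then have "(\<integral>\<^sup>+w. ennreal (norm (indicator ?\<Omega> w *\<^sub>R (cmod (f w))\<^sup>2)) \<partial>lborel) < \<infinity>"
    unfolding set_integrable_def integrable_iff_bounded by blast
  then have "(\<integral>\<^sup>+w. ennreal (indicator ?\<Omega> w *\<^sub>R (cmod (f w))\<^sup>2) \<partial>lborel) < \<infinity>"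
    by (simp add: abs_mult)
  then have fin: "(\<integral>\<^sup>+p. ennreal ((cmod (g p))\<^sup>2) \<partial>(lborel \<Otimes>\<^sub>M lborel)) < \<infinity>"
    using k unfolding nn_integral_hartogs_lift[OF k F] g_def by (auto simp: ennreal_mult_less_top)
  have int: "integrable (lborel \<Otimes>\<^sub>M lborel) g"
  proof (rule integrableI_bounded[OF g])
    have "(\<integral>\<^sup>+p. ennreal (norm (g p)) \<partial>(lborel \<Otimes>\<^sub>M lborel))
        \<le> (\<integral>\<^sup>+p. indicator (ball 0 1 \<times> ball 0 1) p + ennreal ((cmod (g p))\<^sup>2) \<partial>(lborel \<Otimes>\<^sub>M lborel))"
    proof (rule nn_integral_mono)
      fix p :: "complex \<times> complex"
      obtain u v where p: "p = (u, v)" by force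
      show "ennreal (norm (g p)) \<le> indicator (ball 0 1 \<times> ball 0 1) p + ennreal ((cmod (g p))\<^sup>2)"
        using ennreal_leI[OF le_one_plus_power2[of "cmod (g p)"]] supp[of u v]
        by (cases "p \<in> ball 0 1 \<times> (ball 0 1 - {0})") (auto simp: p)
    qed
    also have "\<dots> = emeasure (lborel \<Otimes>\<^sub>M lborel) (ball (0::complex) 1 \<times> ball (0::complex) 1)
        + (\<integral>\<^sup>+p. ennreal ((cmod (g p))\<^sup>2) \<partial>(lborel \<Otimes>\<^sub>M lborel))"
      by (subst nn_integral_add) (auto intro!: borel_measurable_indicator pair_measureI)
    also have "\<dots> < \<infinity>"
      using fin by (simp add: lborel.emeasure_pair_measure_Times emeasure_ball ennreal_mult_less_top)
    finally show "(\<integral>\<^sup>+p. ennreal (norm (g p)) \<partial>(lborel \<Otimes>\<^sub>M lborel)) < \<infinity>" .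
  qed
  let ?S = "\<lambda>p. \<Sum>n=1..k. residue_part k n (\<eta> * cnj (fst p)) * residue_part k n (\<zeta> * cnj (snd p))"
  let ?G = "\<lambda>w. hartogs_kernel k z w * ?F w"
  let ?d = "\<lambda>p::complex\<times>complex. real k * cmod (snd p) ^ (2 * k) * indicator (cball 0 1) (snd p)"
  have m2[measurable]: "{w::complex^2. cmod (w $ 2) \<le> 1} \<in> sets borel"
    by (intro borel_closed closed_Collect_le continuous_intros)
  have cb[measurable]: "cball (0::complex) 1 \<in> sets borel" by simp
  have G: "?G \<in> borel_measurable borel" by measurable
  have "(LINT w:?\<Omega>|lborel. hartogs_kernel k z w * f w)
      = (LINT w|lborel. indicator {w. cmod (w $ 2) \<le> 1} w *\<^sub>R ?G w)"
    unfolding set_lebesgue_integral_def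
    by (intro Bochner_Integration.integral_cong) (auto simp: indicator_def hartogs_triangle_def)
  also have "\<dots> = integral\<^sup>L (density lborel (\<lambda>w. ennreal (indicator {w. cmod (w $ 2) \<le> 1} w))) ?G"
    by (rule integral_density[symmetric]) (use G in auto)
  also have "\<dots> = integral\<^sup>L (distr (density (lborel \<Otimes>\<^sub>M lborel) (\<lambda>p. ennreal (?d p))) borel ?\<Phi>) ?G"
    using density_lborel_eq_distr_hartogs_cover[OF k] by (simp add: ennreal_indicator)
  also have "\<dots> = (LINT p|(lborel \<Otimes>\<^sub>M lborel). ?d p *\<^sub>R ?G (?\<Phi> p))"
  proof (subst integral_distr)
    have "(\<lambda>p. ?G (?\<Phi> p)) \<in> borel_measurable (lborel \<Otimes>\<^sub>M lborel)" by measurable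
    then show "(LINT p|density (lborel \<Otimes>\<^sub>M lborel) (\<lambda>p. ennreal (?d p)). ?G (?\<Phi> p))
        = (LINT p|(lborel \<Otimes>\<^sub>M lborel). ?d p *\<^sub>R ?G (?\<Phi> p))"
      by (rule integral_density) auto
  qed (use G in simp_all)
  also have "\<dots> = (LINT p|(lborel \<Otimes>\<^sub>M lborel). (1 / (of_real (pi\<^sup>2) * \<zeta> ^ k)) * (g p * ?S p))"
  proof (rule Bochner_Integration.integral_cong[OF refl])
    fix p :: "complex \<times> complex"
    obtain u v where p: "p = (u, v)" by force
    show "?d p *\<^sub>R ?G (?\<Phi> p) = (1 / (of_real (pi\<^sup>2) * \<zeta> ^ k)) * (g p * ?S p)"
    proof (cases "u \<in> ball 0 1 \<and> v \<in> ball 0 1 - {0}")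
      case True
      then have "?\<Phi> p \<in> ?\<Omega>" using hartogs_cover_mem_iff[OF k] p by auto
      moreover have "of_real (cmod v ^ (2 * k)) = v ^ k * cnj v ^ k"
      proof -
        have "complex_of_real (cmod v ^ (2 * k)) = (of_real ((cmod v)\<^sup>2)) ^ k" by (simp add: power_mult)
        then show ?thesis by (simp only: complex_norm_square power_mult_distrib)
      qed
      moreover have "hartogs_kernel k z (?\<Phi> p) = ?S p / (of_real (real k * pi\<^sup>2) * (\<zeta> * cnj v) ^ k)"
        unfolding z_eq[symmetric] p using hartogs_kernel_cover[of \<zeta> v k \<eta> u] \<zeta> True by auto
      ultimately show ?thesis
        using True \<zeta> k by (simp add: p gval scaleR_conv_of_real power_mult_distrib field_simps)
    next
      case False
      then have "?\<Phi> p \<notin> ?\<Omega>" using hartogs_cover_mem_iff[OF k] p by auto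
      then show ?thesis by (simp add: g_def hartogs_lift_def)
    qed
  qed
  also have "\<dots> = (1 / (of_real (pi\<^sup>2) * \<zeta> ^ k)) * (of_real (pi\<^sup>2) * g (\<eta>, \<zeta>))"
    unfolding integral_mult_right_zero
    by (subst bidisc_reproducing_symmetric[OF k g supp hol1 hol2 int fin sym \<eta> \<zeta>]) auto
  also have "\<dots> = f z"
    using \<zeta> by (simp add: gval[OF \<eta> \<zeta>] z_eq)
  finally show ?thesis by simp
qed

text \<open>Holomorphy holds because the denominators do not vanish on the triangle. For square integrability, the lift of the kernel
is a bounded function on the bidisc: the factor \<open>v\<^sup>k\<close> of the lift absorbs the pole along \<open>v = 0\<close>.\<close>

lemma cnj_hartogs_kernel_in_bergman_space:
  assumes k: "k \<ge> 1" and z: "z \<in> hartogs_triangle k"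
  shows "(\<lambda>w. cnj (hartogs_kernel k z w)) \<in> bergman_space (hartogs_triangle k)"
proof -
  let ?\<Omega> = "hartogs_triangle k"
  let ?f = "\<lambda>w. cnj (hartogs_kernel k z w)"
  have nz: "1 - cnj (z $ 2) * w $ 2 \<noteq> 0" "cnj (z $ 2) * w $ 2 - (cnj (z $ 1) * w $ 1) ^ k \<noteq> 0" if w: "w \<in> ?\<Omega>" for w
  proof -
    have "cmod (z $ 1) ^ k * cmod (w $ 1) ^ k < cmod (z $ 2) * cmod (w $ 2)"
      using z w by (intro mult_strict_mono') (auto simp: hartogs_triangle_def)
    then show "cnj (z $ 2) * w $ 2 - (cnj (z $ 1) * w $ 1) ^ k \<noteq> 0"
      by (metis complex_mod_cnj eq_iff_diff_eq_0 less_irrefl norm_mult norm_power power_mult_distrib)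
    have "cmod (z $ 2) * cmod (w $ 2) < 1 * 1"
      using z w by (intro mult_strict_mono') (auto simp: hartogs_triangle_def)
    then show "1 - cnj (z $ 2) * w $ 2 \<noteq> 0"
      by (metis complex_mod_cnj eq_iff_diff_eq_0 less_irrefl norm_mult mult_1 norm_one)
  qed
  have hol: "holomorphic_on_Cn ?f ?\<Omega>"
    unfolding holomorphic_on_Cn_iff hartogs_kernel_def Let_def
    using nz k by (auto intro!: complex_differentiable_intros)
  obtain \<eta> \<zeta> where \<eta>: "\<eta> \<in> ball 0 1" and \<zeta>: "\<zeta> \<in> ball 0 1 - {0}" and z_eq: "hartogs_cover k (\<eta>, \<zeta>) = z"
    using hartogs_cover_surj[OF k z] .
  have F[measurable]: "(\<lambda>w. indicator ?\<Omega> w *\<^sub>R ?f w) \<in> borel_measurable borel"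
    by measurable
  define C where "C = (\<Sum>n=1..k. real k / (1 - cmod \<eta>)\<^sup>2 * (real k / (1 - cmod \<zeta>)\<^sup>2)) / (real k * pi\<^sup>2 * cmod \<zeta> ^ k)"
  have C0: "C \<ge> 0" unfolding C_def by (intro divide_nonneg_nonneg sum_nonneg) auto
  have le: "cmod (hartogs_lift k ?f p) \<le> C * indicator (ball 0 1 \<times> ball 0 1) p" for p
  proof -
    obtain u v where p: "p = (u, v)" by force
    show ?thesis
    proof (cases "u \<in> ball 0 1 \<and> v \<in> ball 0 1 - {0}")
      case True
      have ball: "cmod (\<xi> * cnj w) \<le> cmod \<xi>" if "w \<in> ball 0 1" for \<xi> w
        using that mult_left_mono[of "cmod w" 1 "cmod \<xi>"] by (simp add: norm_mult)
      define S where "S = (\<Sum>n=1..k. residue_part k n (\<eta> * cnj u) * residue_part k n (\<zeta> * cnj v))"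
      have "hartogs_kernel k z (hartogs_cover k p) = S / (of_real (real k * pi\<^sup>2) * (\<zeta> * cnj v) ^ k)"
        unfolding z_eq[symmetric] p S_def using hartogs_kernel_cover[of \<zeta> v k \<eta> u] \<zeta> True by auto
      moreover have "hartogs_cover k p \<in> ?\<Omega>" using hartogs_cover_mem_iff[OF k] p True by auto
      ultimately have "cmod (hartogs_lift k ?f p) = cmod S / (real k * pi\<^sup>2 * cmod \<zeta> ^ k)"
        using True by (simp add: hartogs_lift_def p norm_mult norm_divide norm_power power_mult_distrib mult_ac)
      moreover have "cmod S \<le> (\<Sum>n=1..k. real k / (1 - cmod \<eta>)\<^sup>2 * (real k / (1 - cmod \<zeta>)\<^sup>2))"
        unfolding S_def
      proof (rule sum_norm_le)
        fix n assume n: "n \<in> {1..k}"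
        have "cmod (residue_part k n (\<eta> * cnj u)) \<le> real k / (1 - cmod \<eta>)\<^sup>2"
          using ball[of u \<eta>] True \<eta> k n by (intro norm_residue_part_le) auto
        moreover have "cmod (residue_part k n (\<zeta> * cnj v)) \<le> real k / (1 - cmod \<zeta>)\<^sup>2"
          using ball[of v \<zeta>] True \<zeta> k n by (intro norm_residue_part_le) auto
        ultimately show "cmod (residue_part k n (\<eta> * cnj u) * residue_part k n (\<zeta> * cnj v))
            \<le> real k / (1 - cmod \<eta>)\<^sup>2 * (real k / (1 - cmod \<zeta>)\<^sup>2)"
          unfolding norm_mult by (intro mult_mono) auto
      qed
      ultimately have "cmod (hartogs_lift k ?f p) \<le> C"
        unfolding C_def by (simp only:) (intro divide_right_mono, auto)
      then show ?thesis using True p by simp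
    next
      case False
      then have "hartogs_cover k p \<notin> ?\<Omega>" using hartogs_cover_mem_iff[OF k] p by auto
      then show ?thesis using C0 by (simp add: hartogs_lift_def)
    qed
  qed
  have "(\<integral>\<^sup>+p. ennreal ((cmod (hartogs_lift k ?f p))\<^sup>2) \<partial>(lborel \<Otimes>\<^sub>M lborel))
      \<le> (\<integral>\<^sup>+p. ennreal (C\<^sup>2) * indicator (ball (0::complex) 1 \<times> ball (0::complex) 1) p \<partial>(lborel \<Otimes>\<^sub>M lborel))"
  proof (rule nn_integral_mono)
    fix p :: "complex \<times> complex"
    show "ennreal ((cmod (hartogs_lift k ?f p))\<^sup>2) \<le> ennreal (C\<^sup>2) * indicator (ball 0 1 \<times> ball 0 1) p"
      using power_mono[OF le[of p], of 2] C0
      by (cases "p \<in> ball 0 1 \<times> ball 0 1") (auto intro!: ennreal_leI)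
  qed
  also have "\<dots> = ennreal (C\<^sup>2) * emeasure (lborel \<Otimes>\<^sub>M lborel) (ball (0::complex) 1 \<times> ball (0::complex) 1)"
    by (rule nn_integral_cmult_indicator) (auto intro!: pair_measureI)
  also have "\<dots> < \<infinity>"
    by (simp add: lborel.emeasure_pair_measure_Times emeasure_ball ennreal_mult_less_top)
  finally have fin: "(\<integral>\<^sup>+w. ennreal (indicator ?\<Omega> w *\<^sub>R (cmod (?f w))\<^sup>2) \<partial>lborel) < \<infinity>"
    unfolding nn_integral_hartogs_lift[OF k F] by (auto simp: ennreal_mult_less_top)
  have "set_integrable lborel ?\<Omega> (\<lambda>w. (cmod (?f w))\<^sup>2)"
    unfolding set_integrable_def
  proof (rule integrableI_bounded)
    show "(\<lambda>w. indicator ?\<Omega> w *\<^sub>R (cmod (?f w))\<^sup>2) \<in> borel_measurable lborel" by measurable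
    show "(\<integral>\<^sup>+w. ennreal (norm (indicator ?\<Omega> w *\<^sub>R (cmod (?f w))\<^sup>2)) \<partial>lborel) < \<infinity>"
      using fin by (simp add: abs_mult)
  qed
  with hol show ?thesis by (simp add: bergman_space_def)
qed

lemma bergman_kernel_hartogs_triangle:
  assumes k: "k \<ge> 1" and z: "z \<in> hartogs_triangle k" and w: "w \<in> hartogs_triangle k"
  shows "bergman_kernel (hartogs_triangle k) z w = hartogs_kernel k z w"
proof -
  let ?\<Omega> = "hartogs_triangle k"
  define B where "B = (\<lambda>z w. if (z, w) \<in> ?\<Omega> \<times> ?\<Omega> then hartogs_kernel k z w else 0)"
  have B: "is_bergman_kernel ?\<Omega> B"
    unfolding is_bergman_kernel_def
  proof (intro ballI conjI)
    fix z assume z: "z \<in> ?\<Omega>"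
    have eq: "B z w = hartogs_kernel k z w" if "w \<in> ?\<Omega>" for w
      using that z by (simp add: B_def)
    have mem: "(\<lambda>w. cnj (hartogs_kernel k z w)) \<in> bergman_space ?\<Omega>"
      by (rule cnj_hartogs_kernel_in_bergman_space[OF k z])
    have "holomorphic_on_Cn (\<lambda>w. cnj (B z w)) ?\<Omega>"
      unfolding holomorphic_on_Cn_iff
    proof
      fix w assume w: "w \<in> ?\<Omega>"
      then have "complex_differentiable (\<lambda>w. cnj (hartogs_kernel k z w)) w"
        using mem by (auto simp: bergman_space_def holomorphic_on_Cn_iff)
      then show "complex_differentiable (\<lambda>w. cnj (B z w)) w"
        by (rule complex_differentiable_transform[OF _ open_hartogs_triangle w]) (simp add: eq)
    qed
    moreover have "set_integrable lborel ?\<Omega> (\<lambda>w. (cmod (cnj (B z w)))\<^sup>2)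
        \<longleftrightarrow> set_integrable lborel ?\<Omega> (\<lambda>w. (cmod (cnj (hartogs_kernel k z w)))\<^sup>2)"
      by (rule set_integrable_cong) (auto simp: eq)
    ultimately show "(\<lambda>w. cnj (B z w)) \<in> bergman_space ?\<Omega>"
      using mem by (simp add: bergman_space_def)
    fix f assume f: "f \<in> bergman_space ?\<Omega>"
    have "(LINT w:?\<Omega>|lborel. B z w * f w) = (LINT w:?\<Omega>|lborel. hartogs_kernel k z w * f w)"
      by (rule set_lebesgue_integral_cong) (auto simp: eq)
    then show "f z = (LINT w:?\<Omega>|lborel. B z w * f w)"
      using hartogs_kernel_reproducing[OF k z f] by simp
  qed
  have "bergman_kernel ?\<Omega> = B"
    unfolding bergman_kernel_def
  proof (rule the_equality)
    show "is_bergman_kernel ?\<Omega> B \<and> (\<forall>z w. (z, w) \<notin> ?\<Omega> \<times> ?\<Omega> \<longrightarrow> B z w = 0)"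
      using B by (simp add: B_def)
    fix B' assume B': "is_bergman_kernel ?\<Omega> B' \<and> (\<forall>z w. (z, w) \<notin> ?\<Omega> \<times> ?\<Omega> \<longrightarrow> B' z w = 0)"
    show "B' = B"
    proof (intro ext)
      fix z w
      show "B' z w = B z w"
      proof (cases "(z, w) \<in> ?\<Omega> \<times> ?\<Omega>")
        case True
        then show ?thesis
          using bergman_kernel_unique[OF open_hartogs_triangle, of k B' B z w] B B' by auto
      next
        case False
        then show ?thesis using B' by (auto simp: B_def)
      qed
    qed
  qed
  then show ?thesis using z w by (simp add: B_def)
qed

section \<open>Estimate on the diagonal\<close>

text \<open>On the diagonal \<open>s = \<bar>z\<^sub>1\<bar>\<^sup>2\<close> and \<open>t = \<bar>z\<^sub>2\<bar>\<^sup>2\<close>, so \<open>1 - t\<close> and \<open>t - s\<^sup>k\<close> are differences of squares; the factors that can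
become small are split off.\<close>

lemma hartogs_kernel_diagonal:
  fixes z :: "complex ^ 2" and k :: nat
  defines "r \<equiv> cmod (z $ 2)" and "a \<equiv> cmod (z $ 1) ^ k"
  shows "hartogs_kernel k z z = of_real
    ((\<Sum>n=1..k. (cmod (z $ 1))\<^sup>2 ^ (n - 1) * (real n * r\<^sup>2 + real (k - n) * a\<^sup>2) * (real n + real (k - n) * r\<^sup>2))
      / (real k * pi\<^sup>2 * (1 + r)\<^sup>2 * (r + a)\<^sup>2) / ((1 - r)\<^sup>2 * (r - a)\<^sup>2))"
proof -
  have d: "(1 - r\<^sup>2)\<^sup>2 * (r\<^sup>2 - a\<^sup>2)\<^sup>2 = ((1 + r)\<^sup>2 * (r + a)\<^sup>2) * ((1 - r)\<^sup>2 * (r - a)\<^sup>2)"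
    by (simp add: power2_eq_square algebra_simps)
  have s: "z $ 1 * cnj (z $ 1) = of_real ((cmod (z $ 1))\<^sup>2)" "z $ 2 * cnj (z $ 2) = of_real (r\<^sup>2)"
    unfolding r_def complex_norm_square by simp_all
  have sk: "((cmod (z $ 1))\<^sup>2) ^ k = a\<^sup>2"
    by (simp add: a_def power_mult[symmetric] mult.commute)
  have "hartogs_kernel k z z = of_real
    ((\<Sum>n=1..k. (cmod (z $ 1))\<^sup>2 ^ (n - 1) * (real n * r\<^sup>2 + real (k - n) * ((cmod (z $ 1))\<^sup>2) ^ k) * (real n + real (k - n) * r\<^sup>2))
      / (real k * pi\<^sup>2 * (1 - r\<^sup>2)\<^sup>2 * (r\<^sup>2 - ((cmod (z $ 1))\<^sup>2) ^ k)\<^sup>2))"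
    unfolding hartogs_kernel_def Let_def s by simp
  then show ?thesis
    unfolding sk divide_divide_eq_left by (simp only: mult.assoc d)
qed

text \<open>The numerator lies between \<open>r\<^sup>2\<close>, which is already a lower bound for its summand with \<open>n = 1\<close>, and \<open>k\<^sup>3 r\<^sup>2\<close>, the denominator between \<open>k r\<^sup>2\<close> and
\<open>16 k \<pi>\<^sup>2 r\<^sup>2\<close>, because \<open>a < r < 1\<close>. So the factor \<open>r\<^sup>2\<close> cancels.\<close>

lemma hartogs_kernel_factor_bounds:
  fixes k :: nat and s r a :: real
  assumes k: "k \<ge> 1" and s: "0 \<le> s" "s \<le> 1" and a: "0 \<le> a" "a < r" and r: "r < 1"
  defines "Q \<equiv> (\<Sum>n=1..k. s ^ (n - 1) * (real n * r\<^sup>2 + real (k - n) * a\<^sup>2) * (real n + real (k - n) * r\<^sup>2))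
      / (real k * pi\<^sup>2 * (1 + r)\<^sup>2 * (r + a)\<^sup>2)"
  shows "inverse (16 * (real k)\<^sup>2 * pi\<^sup>2) \<le> Q" "Q \<le> 16 * (real k)\<^sup>2 * pi\<^sup>2"
proof -
  define N where "N = (\<Sum>n=1..k. s ^ (n - 1) * (real n * r\<^sup>2 + real (k - n) * a\<^sup>2) * (real n + real (k - n) * r\<^sup>2))"
  have r0: "0 < r" using a by simp
  have pi1: "1 \<le> pi\<^sup>2" using pi_gt3 by (simp add: one_le_power)
  have a2: "a\<^sup>2 \<le> r\<^sup>2" using a by (intro power_mono) auto
  have r2: "r\<^sup>2 \<le> 1" using r r0 by (simp add: power_le_one)
  have Nup: "N \<le> (real k) ^ 3 * r\<^sup>2"
  proof -
    have "N \<le> (\<Sum>n=1..k. (real k)\<^sup>2 * r\<^sup>2)"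
      unfolding N_def
    proof (rule sum_mono)
      fix n assume n: "n \<in> {1..k}"
      have "real n * r\<^sup>2 + real (k - n) * a\<^sup>2 \<le> real n * r\<^sup>2 + real (k - n) * r\<^sup>2"
        using a2 by (intro add_left_mono mult_left_mono) auto
      also have "\<dots> = real k * r\<^sup>2" using n by (simp add: of_nat_diff algebra_simps)
      finally have 1: "real n * r\<^sup>2 + real (k - n) * a\<^sup>2 \<le> real k * r\<^sup>2" .
      have "real n + real (k - n) * r\<^sup>2 \<le> real n + real (k - n) * 1"
        using r2 by (intro add_left_mono mult_left_mono) auto
      also have "\<dots> = real k" using n by simp
      finally have 2: "real n + real (k - n) * r\<^sup>2 \<le> real k" .
      have 3: "s ^ (n - 1) \<le> 1" using s by (simp add: power_le_one)
      have "s ^ (n - 1) * (real n * r\<^sup>2 + real (k - n) * a\<^sup>2) * (real n + real (k - n) * r\<^sup>2) \<le> 1 * (real k * r\<^sup>2) * real k"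
        by (intro mult_mono 1 2 3) (use s in \<open>auto intro!: mult_nonneg_nonneg add_nonneg_nonneg\<close>)
      then show "s ^ (n - 1) * (real n * r\<^sup>2 + real (k - n) * a\<^sup>2) * (real n + real (k - n) * r\<^sup>2) \<le> (real k)\<^sup>2 * r\<^sup>2"
        by (simp add: power2_eq_square mult_ac)
    qed
    then show ?thesis by (simp add: power3_eq_cube power2_eq_square mult_ac)
  qed
  have Nlow: "r\<^sup>2 \<le> N"
  proof -
    have "r\<^sup>2 * 1 \<le> (real 1 * r\<^sup>2 + real (k - 1) * a\<^sup>2) * (real 1 + real (k - 1) * r\<^sup>2)"
      by (intro mult_mono) auto
    also have "\<dots> = s ^ (1 - 1) * (real 1 * r\<^sup>2 + real (k - 1) * a\<^sup>2) * (real 1 + real (k - 1) * r\<^sup>2)" by simp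
    also have "\<dots> \<le> N"
      unfolding N_def using k s
      by (intro member_le_sum[where f="\<lambda>n. s ^ (n - 1) * (real n * r\<^sup>2 + real (k - n) * a\<^sup>2) * (real n + real (k - n) * r\<^sup>2)"]) auto
    finally show ?thesis by simp
  qed
  have k1: "1 \<le> real k" using k by simp
  let ?D = "real k * pi\<^sup>2 * (1 + r)\<^sup>2 * (r + a)\<^sup>2"
  have Dpos: "0 < ?D" using k1 r0 a by (intro mult_pos_pos zero_less_power) auto
  have Dlow: "real k * 1 * 1 * r\<^sup>2 \<le> ?D"
  proof -
    have "1 \<le> (1 + r)\<^sup>2" "r\<^sup>2 \<le> (r + a)\<^sup>2"
      using r0 a by (auto intro!: one_le_power power_mono)
    then show ?thesis using k1 r0 a pi1 by (intro mult_mono) auto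
  qed
  have Dup: "?D \<le> real k * pi\<^sup>2 * 2\<^sup>2 * (2 * r)\<^sup>2"
    using r0 a r k1 by (intro mult_mono power_mono) auto
  have "Q = N / ?D" by (simp add: Q_def N_def)
  have "Q \<le> (real k ^ 3 * r\<^sup>2) / (real k * 1 * 1 * r\<^sup>2)"
    unfolding \<open>Q = N / ?D\<close> using Nup Dlow k1 r0 by (intro frac_le) auto
  also have "\<dots> = (real k)\<^sup>2" using k1 r0 by (simp add: power3_eq_cube power2_eq_square)
  also have "\<dots> \<le> (real k)\<^sup>2 * (16 * pi\<^sup>2)"
    using pi1 by (intro mult_le_cancel_left1[THEN iffD2]) auto
  finally show "Q \<le> 16 * (real k)\<^sup>2 * pi\<^sup>2" by (simp add: mult_ac)
  have "inverse (16 * (real k)\<^sup>2 * pi\<^sup>2) \<le> inverse (16 * real k * pi\<^sup>2)"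
    using k1 by (intro le_imp_inverse_le mult_right_mono mult_left_mono) (auto simp: power2_eq_square)
  also have "\<dots> = r\<^sup>2 / (real k * pi\<^sup>2 * 2\<^sup>2 * (2 * r)\<^sup>2)"
    using r0 k1 by (simp add: field_simps power2_eq_square)
  also have "\<dots> \<le> Q"
    unfolding \<open>Q = N / ?D\<close> using Nlow Dup Dpos order_trans[OF zero_le_power2 Nlow] by (intro frac_le) auto
  finally show "inverse (16 * (real k)\<^sup>2 * pi\<^sup>2) \<le> Q" .
qed

lemma bergman_kernel_hartogs_triangle_bounds:
  fixes k :: nat
  defines "K \<equiv> 16 * (real k)\<^sup>2 * pi\<^sup>2"
  assumes k: "k \<ge> 1" and z: "z \<in> hartogs_triangle k"
  shows "bergman_kernel (hartogs_triangle k) z z \<in> \<real>"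
    and "inverse K / ((1 - cmod (z $ 2))\<^sup>2 * (cmod (z $ 2) - cmod (z $ 1) ^ k)\<^sup>2)
      \<le> Re (bergman_kernel (hartogs_triangle k) z z)"
    and "Re (bergman_kernel (hartogs_triangle k) z z)
      \<le> K / ((1 - cmod (z $ 2))\<^sup>2 * (cmod (z $ 2) - cmod (z $ 1) ^ k)\<^sup>2)"
proof -
  define a where "a = cmod (z $ 1) ^ k"
  define r where "r = cmod (z $ 2)"
  define Q where "Q = (\<Sum>n=1..k. (cmod (z $ 1))\<^sup>2 ^ (n - 1) * (real n * r\<^sup>2 + real (k - n) * a\<^sup>2) * (real n + real (k - n) * r\<^sup>2))
      / (real k * pi\<^sup>2 * (1 + r)\<^sup>2 * (r + a)\<^sup>2)"
  have B: "bergman_kernel (hartogs_triangle k) z z = of_real (Q / ((1 - r)\<^sup>2 * (r - a)\<^sup>2))"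
    unfolding bergman_kernel_hartogs_triangle[OF k z z] hartogs_kernel_diagonal Q_def a_def r_def ..
  have ar: "0 \<le> a" "a < r" "r < 1"
    using z by (auto simp: hartogs_triangle_def a_def r_def)
  then have "cmod (z $ 1) ^ k < 1" by (simp add: a_def)
  then have "cmod (z $ 1) < 1"
    using k by (simp add: power_less_one_iff)
  then have "(cmod (z $ 1))\<^sup>2 \<le> 1" by (simp add: power_le_one)
  then have Q: "inverse K \<le> Q" "Q \<le> K"
    unfolding Q_def K_def using ar by (intro hartogs_kernel_factor_bounds k; simp)+
  show "bergman_kernel (hartogs_triangle k) z z \<in> \<real>" unfolding B by simp
  show "inverse K / ((1 - cmod (z $ 2))\<^sup>2 * (cmod (z $ 2) - cmod (z $ 1) ^ k)\<^sup>2)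
      \<le> Re (bergman_kernel (hartogs_triangle k) z z)"
    unfolding B a_def[symmetric] r_def[symmetric] Re_complex_of_real using Q by (intro divide_right_mono) auto
  show "Re (bergman_kernel (hartogs_triangle k) z z)
      \<le> K / ((1 - cmod (z $ 2))\<^sup>2 * (cmod (z $ 2) - cmod (z $ 1) ^ k)\<^sup>2)"
    unfolding B a_def[symmetric] r_def[symmetric] Re_complex_of_real using Q by (intro divide_right_mono) auto
qed

theorem lemma4p6:
  fixes k :: nat
  assumes "k \<ge> 1"
  shows "\<exists>K::real. K \<ge> 1 \<and> (\<forall>z\<in>hartogs_triangle k.
    bergman_kernel (hartogs_triangle k) z z \<in> \<real> \<and>
    inverse K / ((1 - cmod (z $ 2))\<^sup>2 * (cmod (z $ 2) - cmod (z $ 1) ^ k)\<^sup>2)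
      \<le> Re (bergman_kernel (hartogs_triangle k) z z) \<and>
    Re (bergman_kernel (hartogs_triangle k) z z)
      \<le> K / ((1 - cmod (z $ 2))\<^sup>2 * (cmod (z $ 2) - cmod (z $ 1) ^ k)\<^sup>2))"
proof (intro exI[of _ "16 * (real k)\<^sup>2 * pi\<^sup>2"] conjI ballI)
  have "1 \<le> (real k)\<^sup>2" "1 \<le> pi\<^sup>2" using assms pi_gt3 by (auto simp: one_le_power)
  then have "1 * 1 \<le> (real k)\<^sup>2 * pi\<^sup>2" by (intro mult_mono) auto
  then show "1 \<le> 16 * (real k)\<^sup>2 * pi\<^sup>2" by simp
qed (use bergman_kernel_hartogs_triangle_bounds[OF assms] in auto)

end
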